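(* Let $\mathcal{K}$ be a FUR-class with monster model $\mathbb{M}$, and suppose $p\in S(\mathbb{M})$ is a global type. Then there is some $\alpha\in\mathbb{M}^{eq}$ such that $\alpha$ is a canonical base for $p$.
   Context: SETTING. $(\mathcal{K},\preccurlyeq)$ is an abstract elementary class (AEC) with monster model $\mathbb{M}$: a $\delta$-model homogeneous and $\delta$-universal member of $\mathcal{K}$, $\delta$ a large cardinal. "Model" means $\mathcal{A}\in\mathcal{K}$, $\mathcal{A}\preccurlyeq\mathbb{M}$; models and parameter sets have size $<\delta$ unless $\mathbb{M}$ itself is mentioned. $a\in X$ may be a finite tuple; juxtaposition denotes union or concatenation. TYPES. $\mathrm{Aut}(\mathbb{M}/A)$ is the group of automorphisms of $\mathbb{M}$ fixing $A$ pointwise. $a,b$ have the same Galois type over $A$, $t^g(a/A)=t^g(b/A)$, if $f(a)=b$ for some $f\in\mathrm{Aut}(\mathbb{M}/A)$; they have the same weak type, $t(a/A)=t(b/A)$, if $t^g(a/B)=t^g(b/B)$ for all finite $B\subseteq A$ (types of models are types of enumerations). For $A\subseteq B$ with $A$ finite, $t(a/B)$ splits over $A$ if there are $b,c\in B$ with $t(b/A)=t(c/A)$ but $t(ab/A)\ne t(ac/A)$. $a\downarrow^{ns}_B C$ means that $t(a/B\cup C)$ does not split over some finite $A\subseteq B$; $A\downarrow^{ns}_B C$ means $a\downarrow^{ns}_BC$ for each $a\in A$. FUR-CLASS. $\mathcal{K}$ is a FUR-class if it has AP and JEP, $LS(\mathcal{K})=\omega$, has arbitrarily large structures, contains no finite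 models, and satisfies: (AI) Every countable model $\mathcal{A}$ is s-saturated: for any $b\in\mathbb{M}$ and finite $A\subseteq\mathcal{A}$ there is $a\in\mathcal{A}$ with $t(a/A)=t(b/A)$. (AII) For all $a$ and countable $\mathcal{A}$ there is an s-primary model $\mathcal{B}=\mathcal{A}a\cup\bigcup_{i<\omega}a_i$ over $\mathcal{A}a$. [s-primary: the $a_i$ are singletons and for all $n<\omega$ there is a finite $A_n\subset\mathcal{A}$ such that for all $(a',a_0',\dots,a_n')$ with $t(a'/\mathcal{A})=t(a/\mathcal{A})$: $t(a',a_0',\dots,a_n'/A_n)=t(a,a_0,\dots,a_n/A_n)$ implies $t(a',a_0',\dots,a_n'/\mathcal{A})=t(a,a_0,\dots,a_n/\mathcal{A})$.] (AIII) Let $\mathcal{A},\mathcal{B},\mathcal{C}$ be models with $\mathcal{A}\downarrow^{ns}_{\mathcal{B}}\mathcal{C}$ and $\mathcal{B}=\mathcal{A}\cap\mathcal{C}$. Then there is a unique (not only up to isomorphism) s-prime model $\mathcal{D}$ over $\mathcal{A}\cup\mathcal{C}$; furthermore, if $\mathcal{C}\subseteq\mathcal{C}'$ and $\mathcal{A}\downarrow^{ns}_{\mathcal{B}}\mathcal{C}'$, then $\mathcal{D}\downarrow^{ns}_{\mathcal{C}}\mathcal{C}'$. [For models $\mathcal{A}_i$, $i<\alpha$, and $A=\bigcup_{i<\alpha}\mathcal{A}_i$, a map $f:A\to\mathbb{M}$ is weakly elementary w.r.t. $(\mathcal{A}_i)_{i<\alpha}$ if $t(a/\emptyset)=t(f(a)/\emptyset)$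 for all $a\in A$ and $f(\mathcal{A}_i)\preccurlyeq\mathbb{M}$ for all $i$. A model $\mathcal{D}$ is s-prime over $A$ if for every model $\mathcal{B}$ and every $f:A\to\mathcal{B}$ weakly elementary w.r.t. $(\mathcal{A}_i)_{i<\alpha}$ there is an elementary embedding $g:\mathcal{D}\to\mathcal{B}$ with $f\subseteq g$.] (AIV) For each $a\in\mathbb{M}$ there is $n<\omega$ such that for every countable model $\mathcal{A}$ and finite $A\subset\mathcal{A}$, player II has a winning strategy in $GI(a,A,\mathcal{A})$ in $n$ moves. [$GI(a,A,\mathcal{A})$: start with $a_0=a$, $A_0=A$. At move $n$, player I chooses $a_{n+1}\in\mathbb{M}$ and a finite $A_{n+1}'\subseteq\mathcal{A}$ with $t(a_{n+1}/A_n)=t(a_n/A_n)$, $A_n\subseteq A'_{n+1}$ and $t(a_{n+1}/A'_{n+1})\ne t(a_n/A'_{n+1})$; then player II chooses a finite $A_{n+1}\subseteq\mathcal{A}$ with $A'_{n+1}\subseteq A_{n+1}$. Player II wins if player I can no longer move.] (AV) If $\mathcal{A}\subseteq\mathcal{B}$ are countable models, $a\in\mathbb{M}$ and $\mathcal{B}\downarrow^{ns}_{\mathcal{A}}a$, then $a\downarrow^{ns}_{\mathcal{A}}\mathcal{B}$. (AVI) For all models $\mathcal{A},\mathcal{B},\mathcal{D}$ with $\mathcal{A}\subseteq\mathcal{B}\cap\mathcal{D}$ there is a model $\mathcal{C}$ with $t(\mathcal{C}/\mathcal{A})=t(\mathcal{B}/\mathcal{A})$ and $\mathcal{C}\downarrow^{ns}_{\mathcal{A}}\mathcal{D}$.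 IMAGINARIES. $\mathcal{E}$ is a countable collection of $\emptyset$-invariant equivalence relations $E\subseteq\mathbb{M}^n\times\mathbb{M}^n$ (various $n$), containing equality, each given by a countable collection $G_E$ of Galois types via $(a,b)\in E$ iff $t^g(ab/\emptyset)\in G_E$. $\mathbb{M}^{eq}=\{a/E:a\in\mathbb{M},E\in\mathcal{E}\}$, with $a$ identified with $a/{=}$, the structure of $\mathbb{M}$ on $P_=$, and predicates $P_E$ for $\{a/E:a\in\mathbb{M}\}$ and functions $F_E(a)=a/E$. Automorphisms of $\mathbb{M}$ extend to $\mathbb{M}^{eq}$. GLOBAL TYPES. The supermonster $\mathbb{M}'\in\mathcal{K}$ is a $|\mathbb{M}'|$-model homogeneous and universal structure with $\mathbb{M}\preccurlyeq\mathbb{M}'$ and $|\mathbb{M}'|>|\mathbb{M}|$; every $f\in\mathrm{Aut}(\mathbb{M})$ extends to an automorphism of $\mathbb{M}'$. Types of elements of $\mathbb{M}'$ are computed in $\mathbb{M}'$. A global type $p$ is a maximal collection $\{p_A:A\subset\mathbb{M}\text{ finite}\}$ such that $p_A$ is a Galois type over $A$, whenever $A\subseteq B$ and $b\in\mathbb{M}$ realizes $p_B$ then $b$ realizes $p_A$, and some single $b\in\mathbb{M}'$ realizes $p_A$ for every finite $A\subset\mathbb{M}$. $S(\mathbb{M})$ is the set of global types. For $f\in\mathrm{Aut}(\mathbb{M}^{eq})$, $f(p)=p$ means: for all finite $A,B\subset\mathbb{M}$ with $f(B)=A$ and all $b$ realizing $p_B$, $f(b)$ realizes $p_A$. An element $\alpha\in\mathbb{M}^{eq}$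 is a canonical base for $p$ if for every $f\in\mathrm{Aut}(\mathbb{M}^{eq})$: $f(p)=p$ iff $f(\alpha)=\alpha$. STANDING CHOICE OF $\mathcal{E}$. For $p\in S(\mathbb{M})$ realized by $b\in\mathbb{M}'$ with $t(b/\mathbb{M})$ not splitting over a finite tuple $a\in\mathbb{M}$: for $c\in\mathbb{M}$ let $q_c=t(bc/\emptyset)$ and let $q_i^c$, $i<\omega$, be types over $\emptyset$ such that for all $d\in\mathbb{M}$, $bd$ realizes $q_c$ iff $ad$ realizes $q_i^c$ for some $i<\omega$ (these exist by non-splitting). Let $(a_0,a_1)\in E$ iff for all $c,d\in\mathbb{M}$: $a_0d$ realizes $\bigvee_{i<\omega}q_i^c$ iff $a_1d$ realizes $\bigvee_{i<\omega}q_i^c$. The relation $E$ depends only on $t(ba/\emptyset)$, so there are only countably many such $E$; $\mathcal{E}$ is assumed to contain all of them. *)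

theory Defs
  imports "HOL-Library.Countable_Set"
begin

unbundle cardinal_syntax

section \<open>Structures\<close>

text \<open>
  A vocabulary assigns arities to its relation and function symbols (constants are
  function symbols of arity 0); a symbol mapped to \<^term>\<open>None\<close> does not belong to it.
\<close>

record 's vocab =
  rel_ar :: "'s \<Rightarrow> nat option"
  fun_ar :: "'s \<Rightarrow> nat option"

text \<open>
  Function symbols are interpreted by partial maps, defined exactly on the tuples of the
  right length. Hence a structure over a vocabulary has exactly one representation, and
  isomorphism and substructure can be phrased without mentioning the vocabulary.
\<close>

record ('s, 'a) fostruct =
  univ :: "'a set"
  srel :: "'s \<Rightarrow> 'a list set"
  sfun :: "'s \<Rightarrow> 'a list \<Rightarrow> 'a option"

definition is_struct :: "'s vocab \<Rightarrow> ('s, 'a) fostruct \<Rightarrow> bool" where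
  "is_struct V A \<longleftrightarrow>
     (\<forall>s. srel A s \<subseteq> {xs \<in> lists (univ A). rel_ar V s = Some (length xs)}) \<and>
     (\<forall>s xs. sfun A s xs \<noteq> None \<longleftrightarrow> xs \<in> lists (univ A) \<and> fun_ar V s = Some (length xs)) \<and>
     (\<forall>s xs y. sfun A s xs = Some y \<longrightarrow> y \<in> univ A)"

definition substruct :: "('s, 'a) fostruct \<Rightarrow> ('s, 'a) fostruct \<Rightarrow> bool" where
  "substruct A B \<longleftrightarrow> univ A \<subseteq> univ B \<and>
     (\<forall>s. \<forall>xs \<in> lists (univ A).
        (xs \<in> srel A s \<longleftrightarrow> xs \<in> srel B s) \<and> sfun A s xs = sfun B s xs)"

definition iso :: "('a \<Rightarrow> 'b) \<Rightarrow> ('s, 'a) fostruct \<Rightarrow> ('s, 'b) fostruct \<Rightarrow> bool" where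
  "iso f A B \<longleftrightarrow> bij_betw f (univ A) (univ B) \<and>
     (\<forall>s. \<forall>xs \<in> lists (univ A).
        (xs \<in> srel A s \<longleftrightarrow> map f xs \<in> srel B s) \<and>
        map_option f (sfun A s xs) = sfun B s (map f xs))"

text \<open>Automorphisms are arbitrary outside the universe.\<close>

definition Aut :: "('s, 'a) fostruct \<Rightarrow> ('a \<Rightarrow> 'a) set" where
  "Aut N = {f. iso f N N}"

definition Aut_over :: "('s, 'a) fostruct \<Rightarrow> 'a set \<Rightarrow> ('a \<Rightarrow> 'a) set" where
  "Aut_over N A = {f \<in> Aut N. \<forall>x \<in> A. f x = x}"

definition chain_union :: "('s, 'a) fostruct set \<Rightarrow> ('s, 'a) fostruct" where
  "chain_union \<C> =
     \<lparr> univ = (\<Union>A \<in> \<C>. univ A),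
       srel = (\<lambda>s. \<Union>A \<in> \<C>. srel A s),
       sfun = (\<lambda>s xs. if \<exists>A \<in> \<C>. xs \<in> lists (univ A)
                       then sfun (SOME A. A \<in> \<C> \<and> xs \<in> lists (univ A)) s xs else None) \<rparr>"

section \<open>Abstract elementary classes\<close>

text \<open>
  The type \<^typ>\<open>'a\<close> plays the role of the set-theoretic universe: the members of the class
  are the structures of the class whose elements are taken from \<^typ>\<open>'a\<close>.
\<close>

record ('s, 'a) kclass =
  voc :: "'s vocab"
  members :: "('s, 'a) fostruct set"
  strong :: "('s, 'a) fostruct \<Rightarrow> ('s, 'a) fostruct \<Rightarrow> bool"

text \<open>
  In the chain axioms, an increasing chain indexed by an ordinal is given by the set of its
  members, which is well-ordered by \<^const>\<open>strong\<close>. The axiom asserting the existence of a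
  Loewenheim-Skolem number is subsumed by the definition of \<open>LS_omega\<close> below.
\<close>

definition is_aec :: "('s, 'a) kclass \<Rightarrow> bool" where
  "is_aec \<K> \<longleftrightarrow>
     (\<forall>A \<in> members \<K>. is_struct (voc \<K>) A) \<and>
     (\<forall>A B f. A \<in> members \<K> \<longrightarrow> is_struct (voc \<K>) B \<longrightarrow> iso f A B \<longrightarrow> B \<in> members \<K>) \<and>
     (\<forall>A B A' B' f. strong \<K> A B \<longrightarrow> is_struct (voc \<K>) A' \<longrightarrow> is_struct (voc \<K>) B' \<longrightarrow>
        iso f B B' \<longrightarrow> iso f A A' \<longrightarrow> strong \<K> A' B') \<and>
     (\<forall>A B. strong \<K> A B \<longrightarrow> A \<in> members \<K> \<and> B \<in> members \<K> \<and> substruct A B) \<and>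
     (\<forall>A \<in> members \<K>. strong \<K> A A) \<and>
     (\<forall>A B. strong \<K> A B \<longrightarrow> strong \<K> B A \<longrightarrow> A = B) \<and>
     (\<forall>A B C. strong \<K> A B \<longrightarrow> strong \<K> B C \<longrightarrow> strong \<K> A C) \<and>
     (\<forall>\<C>. \<C> \<noteq> {} \<longrightarrow> \<C> \<subseteq> members \<K> \<longrightarrow>
        well_order_on \<C> {(A, B). A \<in> \<C> \<and> B \<in> \<C> \<and> strong \<K> A B} \<longrightarrow>
        chain_union \<C> \<in> members \<K> \<and>
        (\<forall>A \<in> \<C>. strong \<K> A (chain_union \<C>)) \<and>
        (\<forall>B \<in> members \<K>. (\<forall>A \<in> \<C>. strong \<K> A B) \<longrightarrow> strong \<K> (chain_union \<C>) B)) \<and>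
     (\<forall>A B C. strong \<K> A C \<longrightarrow> strong \<K> B C \<longrightarrow> substruct A B \<longrightarrow> strong \<K> A B)"

text \<open>
  By convention a Loewenheim-Skolem number is infinite and bounds the size of the vocabulary.
\<close>

definition LS_omega :: "('s, 'a) kclass \<Rightarrow> bool" where
  "LS_omega \<K> \<longleftrightarrow>
     countable (dom (rel_ar (voc \<K>))) \<and> countable (dom (fun_ar (voc \<K>))) \<and>
     (\<forall>A \<in> members \<K>. \<forall>X \<subseteq> univ A.
        \<exists>B. strong \<K> B A \<and> X \<subseteq> univ B \<and> |univ B| \<le>o |X| +c natLeq)"

definition elem_emb ::
  "('s, 'a) kclass \<Rightarrow> ('a \<Rightarrow> 'a) \<Rightarrow> ('s, 'a) fostruct \<Rightarrow> ('s, 'a) fostruct \<Rightarrow> bool" where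
  "elem_emb \<K> f A B \<longleftrightarrow> (\<exists>A'. iso f A A' \<and> strong \<K> A' B)"

definition amalgamation :: "('s, 'a) kclass \<Rightarrow> bool" where
  "amalgamation \<K> \<longleftrightarrow>
     (\<forall>A B C f g. A \<in> members \<K> \<longrightarrow> B \<in> members \<K> \<longrightarrow> C \<in> members \<K> \<longrightarrow>
        elem_emb \<K> f A B \<longrightarrow> elem_emb \<K> g A C \<longrightarrow>
        (\<exists>D f' g'. D \<in> members \<K> \<and> elem_emb \<K> f' B D \<and> elem_emb \<K> g' C D \<and>
           (\<forall>x \<in> univ A. f' (f x) = g' (g x))))"

definition joint_embedding :: "('s, 'a) kclass \<Rightarrow> bool" where
  "joint_embedding \<K> \<longleftrightarrow>
     (\<forall>A B. A \<in> members \<K> \<longrightarrow> B \<in> members \<K> \<longrightarrow>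
        (\<exists>C f g. C \<in> members \<K> \<and> elem_emb \<K> f A C \<and> elem_emb \<K> g B C))"

definition arbitrarily_large :: "('s, 'a) kclass \<Rightarrow> bool" where
  "arbitrarily_large \<K> \<longleftrightarrow> (\<forall>X :: 'a set. \<exists>A \<in> members \<K>. |X| \<le>o |univ A| )"

definition model_homogeneous ::
  "('s, 'a) kclass \<Rightarrow> 'd rel \<Rightarrow> ('s, 'a) fostruct \<Rightarrow> bool" where
  "model_homogeneous \<K> \<delta> M \<longleftrightarrow>
     (\<forall>A B f. strong \<K> A M \<longrightarrow> strong \<K> B M \<longrightarrow> |univ A| <o \<delta> \<longrightarrow> |univ B| <o \<delta> \<longrightarrow>
        iso f A B \<longrightarrow> (\<exists>g \<in> Aut M. \<forall>x \<in> univ A. g x = f x))"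

definition model_universal ::
  "('s, 'a) kclass \<Rightarrow> 'd rel \<Rightarrow> ('s, 'a) fostruct \<Rightarrow> bool" where
  "model_universal \<K> \<delta> M \<longleftrightarrow>
     (\<forall>A \<in> members \<K>. |univ A| <o \<delta> \<longrightarrow> (\<exists>f. elem_emb \<K> f A M))"

text \<open>The only largeness required of the cardinal is uncountability.\<close>

definition monster :: "('s, 'a) kclass \<Rightarrow> 'd rel \<Rightarrow> ('s, 'a) fostruct \<Rightarrow> bool" where
  "monster \<K> \<delta> M \<longleftrightarrow> Card_order \<delta> \<and> natLeq <o \<delta> \<and>
     M \<in> members \<K> \<and> model_homogeneous \<K> \<delta> M \<and> model_universal \<K> \<delta> M"

definition is_model ::
  "('s, 'a) kclass \<Rightarrow> 'd rel \<Rightarrow> ('s, 'a) fostruct \<Rightarrow> ('s, 'a) fostruct \<Rightarrow> bool" where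
  "is_model \<K> \<delta> M A \<longleftrightarrow> A \<in> members \<K> \<and> strong \<K> A M \<and> |univ A| <o \<delta>"

section \<open>Types and splitting\<close>

text \<open>
  Finite tuples are lists, and a type of a finite tuple, computed in \<open>N\<close>, is the set of
  its realizations in \<open>N\<close>.
\<close>

definition gtp :: "('s, 'a) fostruct \<Rightarrow> 'a set \<Rightarrow> 'a list \<Rightarrow> 'a list set" where
  "gtp N A a = {b. \<exists>f \<in> Aut_over N A. map f a = b}"

definition wtp :: "('s, 'a) fostruct \<Rightarrow> 'a set \<Rightarrow> 'a list \<Rightarrow> 'a list set" where
  "wtp N A a = {b. \<forall>B \<subseteq> A. finite B \<longrightarrow> gtp N B a = gtp N B b}"

text \<open>
  Equality of the weak types over \<open>A\<close> of two models \<open>B\<close> and \<open>C\<close>: the map \<open>g\<close> matches an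
  enumeration of \<open>B\<close> with one of \<open>C\<close>, and over every finite part of \<open>A\<close> the whole
  enumerations are conjugate.
\<close>

definition same_wtp_models ::
  "('s, 'a) fostruct \<Rightarrow> 'a set \<Rightarrow> ('s, 'a) fostruct \<Rightarrow> ('s, 'a) fostruct \<Rightarrow> bool" where
  "same_wtp_models N A B C \<longleftrightarrow>
     (\<exists>g. g ` univ B = univ C \<and>
        (\<forall>A\<^sub>0 \<subseteq> A. finite A\<^sub>0 \<longrightarrow> (\<exists>f \<in> Aut_over N A\<^sub>0. \<forall>x \<in> univ B. f x = g x)))"

definition splits :: "('s, 'a) fostruct \<Rightarrow> 'a list \<Rightarrow> 'a set \<Rightarrow> 'a set \<Rightarrow> bool" where
  "splits N a B A \<longleftrightarrow>
     (\<exists>b \<in> lists B. \<exists>c \<in> lists B. wtp N A b = wtp N A c \<and> wtp N A (a @ b) \<noteq> wtp N A (a @ c))"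

definition ns_ind :: "('s, 'a) fostruct \<Rightarrow> 'a list \<Rightarrow> 'a set \<Rightarrow> 'a set \<Rightarrow> bool" where
  "ns_ind N a B C \<longleftrightarrow> (\<exists>A \<subseteq> B. finite A \<and> \<not> splits N a (B \<union> C) A)"

definition ns_ind_set :: "('s, 'a) fostruct \<Rightarrow> 'a set \<Rightarrow> 'a set \<Rightarrow> 'a set \<Rightarrow> bool" where
  "ns_ind_set N A B C \<longleftrightarrow> (\<forall>a \<in> lists A. ns_ind N a B C)"

section \<open>FUR-classes\<close>

definition s_saturated :: "('s, 'a) fostruct \<Rightarrow> ('s, 'a) fostruct \<Rightarrow> bool" where
  "s_saturated M \<A> \<longleftrightarrow>
     (\<forall>b \<in> lists (univ M). \<forall>A \<subseteq> univ \<A>. finite A \<longrightarrow>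
        (\<exists>a \<in> lists (univ \<A>). wtp M A a = wtp M A b))"

definition s_primary ::
  "('s, 'a) fostruct \<Rightarrow> ('s, 'a) fostruct \<Rightarrow> 'a list \<Rightarrow> ('s, 'a) fostruct \<Rightarrow> bool" where
  "s_primary M \<A> a \<B> \<longleftrightarrow>
     (\<exists>s :: nat \<Rightarrow> 'a. range s \<subseteq> univ M \<and> univ \<B> = univ \<A> \<union> set a \<union> range s \<and>
        (\<forall>n. \<exists>A \<subseteq> univ \<A>. finite A \<and>
           (\<forall>a' \<in> lists (univ M). \<forall>s' \<in> lists (univ M).
              length s' = Suc n \<longrightarrow>
              wtp M (univ \<A>) a' = wtp M (univ \<A>) a \<longrightarrow>
              wtp M A (a' @ s') = wtp M A (a @ map s [0..<Suc n]) \<longrightarrow>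
              wtp M (univ \<A>) (a' @ s') = wtp M (univ \<A>) (a @ map s [0..<Suc n]))))"

text \<open>
  A family of models is given by the set \<open>\<S>\<close> of its members. The image of \<open>A \<in> \<S>\<close> is
  identified with the substructure of \<open>M\<close> having that universe.
\<close>

definition weakly_elementary ::
  "('s, 'a) kclass \<Rightarrow> ('s, 'a) fostruct \<Rightarrow> ('s, 'a) fostruct set \<Rightarrow> ('a \<Rightarrow> 'a) \<Rightarrow> bool" where
  "weakly_elementary \<K> M \<S> f \<longleftrightarrow>
     (\<forall>a \<in> lists (\<Union>A \<in> \<S>. univ A). map f a \<in> lists (univ M) \<and> wtp M {} a = wtp M {} (map f a)) \<and>
     (\<forall>A \<in> \<S>. \<exists>A'. univ A' = f ` univ A \<and> strong \<K> A' M)"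

text \<open>Since functions are total, \<open>f \<subseteq> g\<close> becomes domain inclusion together with agreement.\<close>

definition s_prime ::
  "('s, 'a) kclass \<Rightarrow> 'd rel \<Rightarrow> ('s, 'a) fostruct \<Rightarrow> ('s, 'a) fostruct set \<Rightarrow>
   ('s, 'a) fostruct \<Rightarrow> bool" where
  "s_prime \<K> \<delta> M \<S> \<D> \<longleftrightarrow>
     is_model \<K> \<delta> M \<D> \<and> (\<Union>A \<in> \<S>. univ A) \<subseteq> univ \<D> \<and>
     (\<forall>\<B> f. is_model \<K> \<delta> M \<B> \<longrightarrow> weakly_elementary \<K> M \<S> f \<longrightarrow>
        f ` (\<Union>A \<in> \<S>. univ A) \<subseteq> univ \<B> \<longrightarrow>
        (\<exists>g. elem_emb \<K> g \<D> \<B> \<and> (\<forall>x \<in> (\<Union>A \<in> \<S>. univ A). g x = f x)))"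

definition gi_move ::
  "('s, 'a) fostruct \<Rightarrow> ('s, 'a) fostruct \<Rightarrow> 'a list \<Rightarrow> 'a set \<Rightarrow> 'a list \<Rightarrow> 'a set \<Rightarrow> bool" where
  "gi_move M \<A> a A a' A' \<longleftrightarrow>
     a' \<in> lists (univ M) \<and> finite A' \<and> A' \<subseteq> univ \<A> \<and> A \<subseteq> A' \<and>
     wtp M A a' = wtp M A a \<and> wtp M A' a' \<noteq> wtp M A' a"

text \<open>
  A strategy \<open>\<sigma>\<close> of player II maps the list of all previous moves of player I to the next
  answer. \<open>gi_play M \<A> a A \<sigma> ms b B\<close> says that player I can legally make the moves \<open>ms\<close>
  against \<open>\<sigma>\<close> and that the position reached is \<open>(b, B)\<close>.
\<close>

inductive gi_play ::
  "('s, 'a) fostruct \<Rightarrow> ('s, 'a) fostruct \<Rightarrow> 'a list \<Rightarrow> 'a set \<Rightarrow>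
   (('a list \<times> 'a set) list \<Rightarrow> 'a set) \<Rightarrow> ('a list \<times> 'a set) list \<Rightarrow> 'a list \<Rightarrow> 'a set \<Rightarrow> bool"
  for M \<A> a A \<sigma> where
  gi_start: "gi_play M \<A> a A \<sigma> [] a A"
| gi_step: "gi_play M \<A> a A \<sigma> ms b B \<Longrightarrow> gi_move M \<A> b B c C \<Longrightarrow>
    gi_play M \<A> a A \<sigma> (ms @ [(c, C)]) c (\<sigma> (ms @ [(c, C)]))"

definition gi_II_wins ::
  "('s, 'a) fostruct \<Rightarrow> ('s, 'a) fostruct \<Rightarrow> 'a list \<Rightarrow> 'a set \<Rightarrow> nat \<Rightarrow> bool" where
  "gi_II_wins M \<A> a A n \<longleftrightarrow>
     (\<exists>\<sigma>. (\<forall>ms c C B. gi_play M \<A> a A \<sigma> (ms @ [(c, C)]) c B \<longrightarrow>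
              finite B \<and> B \<subseteq> univ \<A> \<and> C \<subseteq> B) \<and>
           (\<forall>ms b B. gi_play M \<A> a A \<sigma> ms b B \<longrightarrow> length ms \<le> n))"

definition axiom_AI :: "('s, 'a) kclass \<Rightarrow> 'd rel \<Rightarrow> ('s, 'a) fostruct \<Rightarrow> bool" where
  "axiom_AI \<K> \<delta> M \<longleftrightarrow>
     (\<forall>\<A>. is_model \<K> \<delta> M \<A> \<longrightarrow> countable (univ \<A>) \<longrightarrow> s_saturated M \<A>)"

definition axiom_AII :: "('s, 'a) kclass \<Rightarrow> 'd rel \<Rightarrow> ('s, 'a) fostruct \<Rightarrow> bool" where
  "axiom_AII \<K> \<delta> M \<longleftrightarrow>
     (\<forall>a \<in> lists (univ M). \<forall>\<A>. is_model \<K> \<delta> M \<A> \<longrightarrow> countable (univ \<A>) \<longrightarrow>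
        (\<exists>\<B>. is_model \<K> \<delta> M \<B> \<and> s_primary M \<A> a \<B>))"

definition axiom_AIII :: "('s, 'a) kclass \<Rightarrow> 'd rel \<Rightarrow> ('s, 'a) fostruct \<Rightarrow> bool" where
  "axiom_AIII \<K> \<delta> M \<longleftrightarrow>
     (\<forall>\<A> \<B> \<C>. is_model \<K> \<delta> M \<A> \<longrightarrow> is_model \<K> \<delta> M \<B> \<longrightarrow> is_model \<K> \<delta> M \<C> \<longrightarrow>
        ns_ind_set M (univ \<A>) (univ \<B>) (univ \<C>) \<longrightarrow> univ \<B> = univ \<A> \<inter> univ \<C> \<longrightarrow>
        (\<exists>\<D>. s_prime \<K> \<delta> M {\<A>, \<C>} \<D> \<and> (\<forall>\<D>'. s_prime \<K> \<delta> M {\<A>, \<C>} \<D>' \<longrightarrow> \<D>' = \<D>) \<and>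
           (\<forall>\<C>'. is_model \<K> \<delta> M \<C>' \<longrightarrow> univ \<C> \<subseteq> univ \<C>' \<longrightarrow>
              ns_ind_set M (univ \<A>) (univ \<B>) (univ \<C>') \<longrightarrow>
              ns_ind_set M (univ \<D>) (univ \<C>) (univ \<C>'))))"

definition axiom_AIV :: "('s, 'a) kclass \<Rightarrow> 'd rel \<Rightarrow> ('s, 'a) fostruct \<Rightarrow> bool" where
  "axiom_AIV \<K> \<delta> M \<longleftrightarrow>
     (\<forall>a \<in> lists (univ M). \<exists>n. \<forall>\<A> A. is_model \<K> \<delta> M \<A> \<longrightarrow> countable (univ \<A>) \<longrightarrow>
        A \<subseteq> univ \<A> \<longrightarrow> finite A \<longrightarrow> gi_II_wins M \<A> a A n)"

definition axiom_AV :: "('s, 'a) kclass \<Rightarrow> 'd rel \<Rightarrow> ('s, 'a) fostruct \<Rightarrow> bool" where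
  "axiom_AV \<K> \<delta> M \<longleftrightarrow>
     (\<forall>\<A> \<B>. is_model \<K> \<delta> M \<A> \<longrightarrow> is_model \<K> \<delta> M \<B> \<longrightarrow> countable (univ \<A>) \<longrightarrow>
        countable (univ \<B>) \<longrightarrow> univ \<A> \<subseteq> univ \<B> \<longrightarrow>
        (\<forall>a \<in> lists (univ M). ns_ind_set M (univ \<B>) (univ \<A>) (set a) \<longrightarrow>
           ns_ind M a (univ \<A>) (univ \<B>)))"

definition axiom_AVI :: "('s, 'a) kclass \<Rightarrow> 'd rel \<Rightarrow> ('s, 'a) fostruct \<Rightarrow> bool" where
  "axiom_AVI \<K> \<delta> M \<longleftrightarrow>
     (\<forall>\<A> \<B> \<D>. is_model \<K> \<delta> M \<A> \<longrightarrow> is_model \<K> \<delta> M \<B> \<longrightarrow> is_model \<K> \<delta> M \<D> \<longrightarrow>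
        univ \<A> \<subseteq> univ \<B> \<inter> univ \<D> \<longrightarrow>
        (\<exists>\<C>. is_model \<K> \<delta> M \<C> \<and> same_wtp_models M (univ \<A>) \<B> \<C> \<and>
           ns_ind_set M (univ \<C>) (univ \<A>) (univ \<D>)))"

definition fur_class :: "('s, 'a) kclass \<Rightarrow> 'd rel \<Rightarrow> ('s, 'a) fostruct \<Rightarrow> bool" where
  "fur_class \<K> \<delta> M \<longleftrightarrow>
     is_aec \<K> \<and> LS_omega \<K> \<and> amalgamation \<K> \<and> joint_embedding \<K> \<and> arbitrarily_large \<K> \<and>
     (\<forall>A \<in> members \<K>. infinite (univ A)) \<and>
     axiom_AI \<K> \<delta> M \<and> axiom_AII \<K> \<delta> M \<and> axiom_AIII \<K> \<delta> M \<and>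
     axiom_AIV \<K> \<delta> M \<and> axiom_AV \<K> \<delta> M \<and> axiom_AVI \<K> \<delta> M"

section \<open>Imaginaries\<close>

definition tuples :: "('s, 'a) fostruct \<Rightarrow> nat \<Rightarrow> 'a list set" where
  "tuples M n = {a \<in> lists (univ M). length a = n}"

definition equality_rel :: "('s, 'a) fostruct \<Rightarrow> 'a list rel" where
  "equality_rel M = Id_on (tuples M 1)"

definition imaginary_rels :: "('s, 'a) fostruct \<Rightarrow> 'a list rel set \<Rightarrow> bool" where
  "imaginary_rels M \<E> \<longleftrightarrow> countable \<E> \<and> equality_rel M \<in> \<E> \<and>
     (\<forall>E \<in> \<E>. \<exists>n. equiv (tuples M n) E \<and>
        (\<forall>f \<in> Aut M. \<forall>(a, b) \<in> E. (map f a, map f b) \<in> E) \<and>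
        (\<exists>G \<subseteq> gtp M {} ` lists (univ M). countable G \<and>
           (\<forall>a \<in> tuples M n. \<forall>b \<in> tuples M n. (a, b) \<in> E \<longleftrightarrow> gtp M {} (a @ b) \<in> G)))"

text \<open>
  The imaginary \<open>a/E\<close> carries its relation along, so that the sorts are disjoint;
  \<open>home M x\<close> is the imaginary identified with the element \<open>x\<close>.
\<close>

type_synonym 'a imag = "'a list rel \<times> 'a list set"

definition imag :: "'a list rel \<Rightarrow> 'a list \<Rightarrow> 'a imag" where
  "imag E a = (E, E `` {a})"

definition home :: "('s, 'a) fostruct \<Rightarrow> 'a \<Rightarrow> 'a imag" where
  "home M x = imag (equality_rel M) [x]"

definition unhome :: "('s, 'a) fostruct \<Rightarrow> 'a imag \<Rightarrow> 'a" where
  "unhome M = the_inv_into (univ M) (home M)"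

text \<open>
  Symbols \<^term>\<open>Inl s\<close> carry the structure of \<open>M\<close> on the home sort; the relation symbol
  \<^term>\<open>Inr E\<close> is \<open>P\<^sub>E\<close> and the function symbol \<^term>\<open>Inr E\<close> is the partial
  function \<open>F\<^sub>E\<close>. Note that \<^term>\<open>Field E\<close> is the set of \<open>n\<close>-tuples on which \<open>E\<close> lives.
\<close>

definition Meq ::
  "('s, 'a) fostruct \<Rightarrow> 'a list rel set \<Rightarrow> ('s + 'a list rel, 'a imag) fostruct" where
  "Meq M \<E> =
     \<lparr> univ = {imag E a | E a. E \<in> \<E> \<and> a \<in> Field E},
       srel = (\<lambda>S. case S of
           Inl s \<Rightarrow> map (home M) ` srel M s
         | Inr E \<Rightarrow> {[imag E a] | a. E \<in> \<E> \<and> a \<in> Field E}),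
       sfun = (\<lambda>S xs.
         if xs \<in> lists (home M ` univ M)
         then (case S of
             Inl s \<Rightarrow> map_option (home M) (sfun M s (map (unhome M) xs))
           | Inr E \<Rightarrow> if E \<in> \<E> \<and> map (unhome M) xs \<in> Field E
                      then Some (imag E (map (unhome M) xs)) else None)
         else None) \<rparr>"

section \<open>Global types and canonical bases\<close>

definition supermonster ::
  "('s, 'a) kclass \<Rightarrow> ('s, 'a) fostruct \<Rightarrow> ('s, 'a) fostruct \<Rightarrow> bool" where
  "supermonster \<K> M M' \<longleftrightarrow>
     M' \<in> members \<K> \<and> strong \<K> M M' \<and> |univ M| <o |univ M'| \<and>
     model_homogeneous \<K> |univ M'| M' \<and> model_universal \<K> |univ M'| M' \<and>
     (\<forall>f \<in> Aut M. \<exists>g \<in> Aut M'. \<forall>x \<in> univ M. g x = f x)"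

text \<open>
  The family \<open>(p\<^sub>A)\<close> is a function on the finite subsets of \<open>M\<close> (extended by the empty set to
  all other sets). Its being defined at every finite \<open>A\<close> is the maximality of the collection:
  a single tuple realizes all its members, so it contains at most one type over each \<open>A\<close>, and
  the types of that tuple over the remaining \<open>A\<close> can always be added.
\<close>

definition global_types ::
  "('s, 'a) fostruct \<Rightarrow> ('s, 'a) fostruct \<Rightarrow> ('a set \<Rightarrow> 'a list set) set" where
  "global_types M M' = {p.
     (\<forall>A. finite A \<and> A \<subseteq> univ M \<longrightarrow> p A \<in> gtp M' A ` lists (univ M')) \<and>
     (\<forall>A. \<not> (finite A \<and> A \<subseteq> univ M) \<longrightarrow> p A = {}) \<and>
     (\<forall>A B. finite B \<longrightarrow> B \<subseteq> univ M \<longrightarrow> A \<subseteq> B \<longrightarrow> (\<forall>b \<in> lists (univ M). b \<in> p B \<longrightarrow> b \<in> p A)) \<and>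
     (\<exists>b \<in> lists (univ M'). \<forall>A \<subseteq> univ M. finite A \<longrightarrow> b \<in> p A)}"

text \<open>\<open>f(p) = p\<close>, for an automorphism \<open>f\<close> of the structure of imaginaries.\<close>

definition fixes_global_type ::
  "('s, 'a) fostruct \<Rightarrow> ('a imag \<Rightarrow> 'a imag) \<Rightarrow> ('a set \<Rightarrow> 'a list set) \<Rightarrow> bool" where
  "fixes_global_type M f p \<longleftrightarrow>
     (let f\<^sub>M = (\<lambda>x. unhome M (f (home M x))) in
       \<forall>A B. finite A \<longrightarrow> finite B \<longrightarrow> A \<subseteq> univ M \<longrightarrow> B \<subseteq> univ M \<longrightarrow> f\<^sub>M ` B = A \<longrightarrow>
         (\<forall>b \<in> lists (univ M). b \<in> p B \<longrightarrow> map f\<^sub>M b \<in> p A))"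

definition canonical_base ::
  "('s, 'a) fostruct \<Rightarrow> 'a list rel set \<Rightarrow> 'a imag \<Rightarrow> ('a set \<Rightarrow> 'a list set) \<Rightarrow> bool" where
  "canonical_base M \<E> \<alpha> p \<longleftrightarrow> \<alpha> \<in> univ (Meq M \<E>) \<and>
     (\<forall>f \<in> Aut (Meq M \<E>). fixes_global_type M f p \<longleftrightarrow> f \<alpha> = \<alpha>)"

text \<open>
  \<open>q c i\<close> is a type \<open>q\<^sub>i\<^sup>c\<close> over the empty set such that, for all \<open>d\<close> in \<open>M\<close>, \<open>bd\<close> realizes
  the type of \<open>bc\<close> iff \<open>ad\<close> realizes some \<open>q\<^sub>i\<^sup>c\<close>.
\<close>

definition defining_types ::
  "('s, 'a) fostruct \<Rightarrow> ('s, 'a) fostruct \<Rightarrow> 'a list \<Rightarrow> 'a list \<Rightarrow>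
   ('a list \<Rightarrow> nat \<Rightarrow> 'a list set) \<Rightarrow> bool" where
  "defining_types M M' b a q \<longleftrightarrow>
     (\<forall>c \<in> lists (univ M).
        (\<forall>i. q c i \<in> wtp M' {} ` lists (univ M')) \<and>
        (\<forall>d \<in> lists (univ M). b @ d \<in> wtp M' {} (b @ c) \<longleftrightarrow> (\<exists>i. a @ d \<in> q c i)))"

definition defining_rel ::
  "('s, 'a) fostruct \<Rightarrow> nat \<Rightarrow> ('a list \<Rightarrow> nat \<Rightarrow> 'a list set) \<Rightarrow> 'a list rel" where
  "defining_rel M n q =
     {(a\<^sub>0, a\<^sub>1). a\<^sub>0 \<in> tuples M n \<and> a\<^sub>1 \<in> tuples M n \<and>
        (\<forall>c \<in> lists (univ M). \<forall>d \<in> lists (univ M).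
           (\<exists>i. a\<^sub>0 @ d \<in> q c i) \<longleftrightarrow> (\<exists>i. a\<^sub>1 @ d \<in> q c i))}"

text \<open>
  The types \<open>q\<^sub>i\<^sup>c\<close> are not determined by \<open>a\<close> and \<open>b\<close> (types realized by no tuple \<open>ad\<close> may
  be added); only the relation obtained from one such choice is required to be present.
\<close>

definition contains_defining_rels ::
  "('s, 'a) fostruct \<Rightarrow> ('s, 'a) fostruct \<Rightarrow> 'a list rel set \<Rightarrow> bool" where
  "contains_defining_rels M M' \<E> \<longleftrightarrow>
     (\<forall>p \<in> global_types M M'. \<forall>b \<in> lists (univ M'). \<forall>a \<in> lists (univ M).
        (\<forall>A \<subseteq> univ M. finite A \<longrightarrow> b \<in> p A) \<longrightarrow> \<not> splits M' b (univ M) (set a) \<longrightarrow>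
        (\<exists>q. defining_types M M' b a q \<and> defining_rel M (length a) q \<in> \<E>))"

end

theory Submission
  imports Defs "HOL-Library.Countable_Set_Type"
begin

text \<open>
  If the type over \<open>M\<close> of a realization \<open>b\<close> of \<open>p\<close> split over every finite set, then one could
  close off under automorphisms of \<open>M\<close> witnessing the splitting, and obtain a countable model \<open>\<A>\<close>
  preserved by such witnesses for all its finite subsets. Move \<open>b\<close> into \<open>M\<close> over \<open>\<A>\<close>; then player I
  can go on forever in the game of (AIV) by applying the witnesses to the current tuple. So the
  type of \<open>b\<close> does not split over some finite tuple \<open>a\<close>. If \<open>g\<close> extends an automorphism of \<open>M\<close>, then
  \<open>g(a)d\<close> realizes \<open>\<Or>\<^sub>i q\<^sub>i\<^sup>c\<close> iff \<open>g(b)d\<close> and \<open>bc\<close> have the same type. Hence \<open>a\<close> and \<open>g(a)\<close> are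
  \<open>E\<close>-equivalent iff \<open>b\<close> and \<open>g(b)\<close> have the same type over \<open>M\<close>, which is what fixing \<open>p\<close> means, and
  \<open>a/E\<close> is a canonical base.
\<close>

section \<open>Isomorphisms and automorphisms\<close>

lemma
  assumes "iso f A B"
  shows iso_bij: "bij_betw f (univ A) (univ B)"
    and iso_rel: "xs \<in> lists (univ A) \<Longrightarrow> map f xs \<in> srel B s \<longleftrightarrow> xs \<in> srel A s"
    and iso_fun: "xs \<in> lists (univ A) \<Longrightarrow> sfun B s (map f xs) = map_option f (sfun A s xs)"
  using assms by (auto simp: iso_def)

lemma map_bij_lists:
  assumes "bij_betw f A B" "ys \<in> lists B"
  obtains xs where "xs \<in> lists A" "ys = map f xs"
proof -
  have "ys \<in> map f ` lists A"
    using assms unfolding bij_betw_def by (metis lists_image)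
  then show ?thesis
    using that by blast
qed

lemma map_inj_lists_eq_iff:
  assumes "inj_on f A" "xs \<in> lists A" "ys \<in> lists A"
  shows "map f xs = map f ys \<longleftrightarrow> xs = ys"
proof -
  have "inj_on f (set xs \<union> set ys)"
    using assms by (auto intro: inj_on_subset[of f A])
  then show ?thesis
    by (rule inj_on_map_eq_map)
qed

lemma map_inv_into_map:
  assumes "inj_on f A" "xs \<in> lists A"
  shows "map (inv_into A f) (map f xs) = xs"
  using assms by (induction xs) auto

lemma map_in_lists: "f ` A \<subseteq> B \<Longrightarrow> xs \<in> lists A \<Longrightarrow> map f xs \<in> lists B"
  by (auto simp: in_lists_conv_set)

lemma iso_lists:
  assumes "iso f A B" "xs \<in> lists (univ A)"
  shows "map f xs \<in> lists (univ B)"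
  using iso_bij[OF assms(1)] assms(2) by (intro map_in_lists[of f "univ A"]) (auto simp: bij_betw_def)

lemma iso_comp:
  assumes "iso f A B" "iso g B C"
  shows "iso (g \<circ> f) A C"
proof -
  have "map (g \<circ> f) xs \<in> srel C s \<longleftrightarrow> xs \<in> srel A s"
    and "map_option (g \<circ> f) (sfun A s xs) = sfun C s (map (g \<circ> f) xs)"
    if "xs \<in> lists (univ A)" for s xs
    using that iso_lists[OF assms(1) that] iso_rel[OF assms(1)] iso_rel[OF assms(2)]
      iso_fun[OF assms(1)] iso_fun[OF assms(2)]
    by (simp_all only: map_map[symmetric] option.map_comp)
  then show ?thesis
    using bij_betw_trans[OF iso_bij[OF assms(1)] iso_bij[OF assms(2)]] by (simp add: iso_def)
qed

text \<open>\<open>is_struct\<close> puts the values of function symbols into \<open>univ A\<close>,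
  where \<open>inv_into (univ A) f\<close> undoes \<open>f\<close>.\<close>

lemma iso_inv_into:
  assumes "is_struct V A" "iso f A B"
  shows "iso (inv_into (univ A) f) B A"
proof -
  let ?g = "inv_into (univ A) f"
  note bij = iso_bij[OF assms(2)]
  have inj: "inj_on f (univ A)"
    using bij by (simp add: bij_betw_def)
  have "(ys \<in> srel B s \<longleftrightarrow> map ?g ys \<in> srel A s) \<and>
      map_option ?g (sfun B s ys) = sfun A s (map ?g ys)" if ys: "ys \<in> lists (univ B)" for s ys
  proof -
    obtain xs where xs: "xs \<in> lists (univ A)" "ys = map f xs"
      using map_bij_lists[OF bij ys] .
    have "map_option (?g \<circ> f) (sfun A s xs) = sfun A s xs"
    proof (cases "sfun A s xs")
      case (Some y)
      then have "y \<in> univ A"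
        using assms(1) by (auto simp: is_struct_def)
      with Some inj show ?thesis by simp
    qed simp
    moreover have "map ?g ys = xs"
      using map_inv_into_map[OF inj xs(1)] xs(2) by simp
    ultimately show ?thesis
      using xs iso_rel[OF assms(2)] iso_fun[OF assms(2)] by (simp add: option.map_comp)
  qed
  then show ?thesis
    using bij_betw_inv_into[OF bij] by (simp add: iso_def)
qed

text \<open>Function symbols are cut off outside the image because a structure has to be undefined
  there; \<open>inv_into\<close> recovers the original arguments.\<close>

definition image_struct :: "('a \<Rightarrow> 'a) \<Rightarrow> ('s, 'a) fostruct \<Rightarrow> ('s, 'a) fostruct" where
  "image_struct f A =
     \<lparr> univ = f ` univ A,
       srel = (\<lambda>s. map f ` srel A s),
       sfun = (\<lambda>s ys. if ys \<in> lists (f ` univ A)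
                      then map_option f (sfun A s (map (inv_into (univ A) f) ys)) else None) \<rparr>"

lemma univ_image_struct [simp]: "univ (image_struct f A) = f ` univ A"
  by (simp add: image_struct_def)

lemma
  assumes "is_struct V A" "inj_on f (univ A)"
  shows is_struct_image_struct: "is_struct V (image_struct f A)"
    and iso_image_struct: "iso f A (image_struct f A)"
proof -
  let ?B = "image_struct f A"
  have bij: "bij_betw f (univ A) (f ` univ A)"
    using assms(2) by (rule inj_on_imp_bij_betw)
  have rel: "srel A s \<subseteq> {xs \<in> lists (univ A). rel_ar V s = Some (length xs)}" for s
    using assms(1) by (simp add: is_struct_def)
  have sfun: "sfun ?B s (map f xs) = map_option f (sfun A s xs)" if "xs \<in> lists (univ A)" for s xs
    using that map_inv_into_map[OF assms(2) that] map_in_lists[of f "univ A", OF subset_refl that]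
    by (simp add: image_struct_def del: map_map)
  have sfun_dom: "sfun ?B s ys = None" if "ys \<notin> lists (f ` univ A)" for s ys
    using that by (simp add: image_struct_def)
  have "map f xs \<in> srel ?B s \<longleftrightarrow> xs \<in> srel A s" if "xs \<in> lists (univ A)" for s xs
    using that rel[of s] map_inj_lists_eq_iff[OF assms(2) that]
    by (fastforce simp: image_struct_def)
  with bij sfun show "iso f A ?B"
    by (simp add: iso_def)
  have "(sfun ?B s ys \<noteq> None \<longleftrightarrow> ys \<in> lists (univ ?B) \<and> fun_ar V s = Some (length ys)) \<and>
      (\<forall>y. sfun ?B s ys = Some y \<longrightarrow> y \<in> univ ?B)" for s ys
  proof (cases "ys \<in> lists (f ` univ A)")
    case True
    obtain xs where "xs \<in> lists (univ A)" "ys = map f xs"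
      using map_bij_lists[OF bij True] .
    then show ?thesis
      using True assms(1) sfun[of xs s] unfolding is_struct_def by auto
  qed (simp add: sfun_dom)
  moreover have "srel ?B s \<subseteq> {xs \<in> lists (univ ?B). rel_ar V s = Some (length xs)}" for s
    using rel[of s] by (force simp: image_struct_def in_lists_conv_set)
  ultimately show "is_struct V ?B"
    unfolding is_struct_def by blast
qed

section \<open>Automorphisms and their inverses on the universe\<close>

lemma Aut_comp: "f \<in> Aut N \<Longrightarrow> g \<in> Aut N \<Longrightarrow> g \<circ> f \<in> Aut N"
  using iso_comp by (auto simp: Aut_def)

lemma Aut_bij: "f \<in> Aut N \<Longrightarrow> bij_betw f (univ N) (univ N)"
  by (simp add: Aut_def iso_bij)

lemma Aut_lists: "f \<in> Aut N \<Longrightarrow> a \<in> lists (univ N) \<Longrightarrow> map f a \<in> lists (univ N)"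
  by (simp add: Aut_def iso_lists)

lemma Aut_image_subset: "f \<in> Aut N \<Longrightarrow> A \<subseteq> univ N \<Longrightarrow> f ` A \<subseteq> univ N"
  using Aut_bij[of f N] by (auto simp: bij_betw_def)

lemma Aut_inverse:
  assumes "is_struct V N" "f \<in> Aut N"
  obtains g where "g \<in> Aut N" "\<And>x. x \<in> univ N \<Longrightarrow> g (f x) = x" "\<And>x. x \<in> univ N \<Longrightarrow> f (g x) = x"
proof
  have bij: "bij_betw f (univ N) (univ N)"
    by (rule Aut_bij[OF assms(2)])
  show "inv_into (univ N) f \<in> Aut N"
    using assms by (auto simp: Aut_def intro: iso_inv_into)
  show "inv_into (univ N) f (f x) = x" "f (inv_into (univ N) f x) = x" if "x \<in> univ N" for x
    using bij that by (simp_all add: bij_betw_inv_into_left bij_betw_inv_into_right)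
qed

lemma Aut_overI: "f \<in> Aut N \<Longrightarrow> (\<And>x. x \<in> A \<Longrightarrow> f x = x) \<Longrightarrow> f \<in> Aut_over N A"
  by (simp add: Aut_over_def)

lemma Aut_overD: "f \<in> Aut_over N A \<Longrightarrow> f \<in> Aut N" "f \<in> Aut_over N A \<Longrightarrow> x \<in> A \<Longrightarrow> f x = x"
  by (simp_all add: Aut_over_def)

lemma Aut_over_mono: "A \<subseteq> B \<Longrightarrow> f \<in> Aut_over N B \<Longrightarrow> f \<in> Aut_over N A"
  by (auto simp: Aut_over_def)

section \<open>Types\<close>

text \<open>The orbit relation replaces equality of types: inside the universe,
  \<open>gtp_eq_iff\<close> and, over finite sets, \<open>in_wtp_iff\<close> and
  \<open>wtp_eq_iff\<close> translate into it.\<close>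

definition conj_over :: "('s, 'a) fostruct \<Rightarrow> 'a set \<Rightarrow> 'a list \<Rightarrow> 'a list \<Rightarrow> bool" where
  "conj_over N A a b \<longleftrightarrow> (\<exists>f \<in> Aut_over N A. map f a = b)"

lemma in_gtp_iff: "b \<in> gtp N A a \<longleftrightarrow> conj_over N A a b"
  by (simp add: gtp_def conj_over_def)

lemma conj_over_refl: "conj_over N A a a"
proof -
  have "id \<in> Aut_over N A"
    by (simp add: Aut_over_def Aut_def iso_def option.map_id)
  then show ?thesis
    unfolding conj_over_def by (metis list.map_id)
qed

lemma conj_over_trans: "conj_over N A a b \<Longrightarrow> conj_over N A b c \<Longrightarrow> conj_over N A a c"
proof -
  assume "conj_over N A a b" "conj_over N A b c"
  then obtain f g where fg: "f \<in> Aut_over N A" "map f a = b" "g \<in> Aut_over N A" "map g b = c"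
    by (auto simp: conj_over_def)
  then have "g \<circ> f \<in> Aut_over N A"
    by (auto simp: Aut_over_def intro: Aut_comp)
  moreover have "map (g \<circ> f) a = c"
    using fg(2,4) by auto
  ultimately show ?thesis
    by (auto simp: conj_over_def)
qed

lemma conj_over_mono: "A \<subseteq> B \<Longrightarrow> conj_over N B a b \<Longrightarrow> conj_over N A a b"
  unfolding conj_over_def using Aut_over_mono by blast

text \<open>The witness is inverted. Automorphisms are controlled only on the universe, hence the
  conditions on \<open>A\<close> and \<open>a\<close>.\<close>

lemma conj_over_sym:
  assumes "is_struct V N" "A \<subseteq> univ N" "a \<in> lists (univ N)" "conj_over N A a b"
  shows "conj_over N A b a"
proof -
  obtain f where f: "f \<in> Aut_over N A" "map f a = b"
    using assms(4) by (auto simp: conj_over_def)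
  obtain g where g: "g \<in> Aut N" "\<And>x. x \<in> univ N \<Longrightarrow> g (f x) = x"
    using Aut_inverse[OF assms(1) Aut_overD(1)[OF f(1)]] by metis
  have "g \<in> Aut_over N A"
    using g assms(2) f(1) by (intro Aut_overI) (metis Aut_overD(2) subsetD)+
  moreover have "map g b = a"
    unfolding f(2)[symmetric] using assms(3) g(2) by (simp add: map_idI in_lists_conv_set)
  ultimately show ?thesis
    by (auto simp: conj_over_def)
qed

lemma gtp_eq_iff:
  assumes "is_struct V N" "A \<subseteq> univ N" "a \<in> lists (univ N)"
  shows "gtp N A a = gtp N A b \<longleftrightarrow> conj_over N A a b"
proof
  assume "gtp N A a = gtp N A b"
  then show "conj_over N A a b"
    using conj_over_refl in_gtp_iff by blast
next
  assume ab: "conj_over N A a b"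
  show "gtp N A a = gtp N A b"
    using conj_over_sym[OF assms ab] ab conj_over_trans
    by (auto simp: in_gtp_iff)
qed

text \<open>Over a finite \<open>A\<close> the weak type tests \<open>A\<close> itself, and a
  conjugation over \<open>A\<close> is one over each of its subsets. So weak and Galois types agree
  there.\<close>

lemma in_wtp_iff:
  assumes "is_struct V N" "finite A" "A \<subseteq> univ N" "a \<in> lists (univ N)"
  shows "b \<in> wtp N A a \<longleftrightarrow> conj_over N A a b"
proof
  assume "b \<in> wtp N A a"
  then have "gtp N A a = gtp N A b"
    using assms(2) by (simp add: wtp_def)
  then show "conj_over N A a b"
    by (simp add: gtp_eq_iff[OF assms(1,3,4)])
next
  assume ab: "conj_over N A a b"
  have "gtp N B a = gtp N B b" if "B \<subseteq> A" for B
    using gtp_eq_iff[OF assms(1) _ assms(4)] conj_over_mono[OF that ab] that assms(3) by blast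
  then show "b \<in> wtp N A a"
    by (simp add: wtp_def)
qed

lemma wtp_eq_iff:
  assumes "is_struct V N" "finite A" "A \<subseteq> univ N" "a \<in> lists (univ N)" "b \<in> lists (univ N)"
  shows "wtp N A a = wtp N A b \<longleftrightarrow> conj_over N A a b"
proof
  assume "wtp N A a = wtp N A b"
  then show "conj_over N A a b"
    using in_wtp_iff[OF assms(1-4)] in_wtp_iff[OF assms(1-3,5)] conj_over_refl by blast
next
  assume ab: "conj_over N A a b"
  then show "wtp N A a = wtp N A b"
    using in_wtp_iff[OF assms(1-4)] in_wtp_iff[OF assms(1-3,5)]
      conj_over_sym[OF assms(1,3,4) ab] conj_over_trans by blast
qed

text \<open>A witness \<open>f\<close> over \<open>A\<close> is conjugated to
  \<open>g \<circ> f \<circ> h\<close>, with \<open>h\<close> inverse to \<open>g\<close> on the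
  universe; this fixes the image of \<open>A\<close> pointwise.\<close>

lemma conj_over_image:
  assumes "is_struct V N" "A \<subseteq> univ N" "a \<in> lists (univ N)" "g \<in> Aut N" "conj_over N A a b"
  shows "conj_over N (g ` A) (map g a) (map g b)"
proof -
  obtain f where f: "f \<in> Aut_over N A" "map f a = b"
    using assms(5) by (auto simp: conj_over_def)
  obtain h where h: "h \<in> Aut N" "\<And>x. x \<in> univ N \<Longrightarrow> h (g x) = x"
    using Aut_inverse[OF assms(1,4)] by metis
  have "g \<circ> f \<circ> h \<in> Aut_over N (g ` A)"
    using f h assms(2,4) by (auto simp: Aut_over_def intro!: Aut_comp)
  moreover have "map (g \<circ> f \<circ> h) (map g a) = map g b"
    unfolding f(2)[symmetric] using assms(3) h(2) by (auto simp: in_lists_conv_set)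
  ultimately show ?thesis
    unfolding conj_over_def by blast
qed

lemma conj_over_append:
  assumes "conj_over N A a b" "set d \<subseteq> A"
  shows "conj_over N A (a @ d) (b @ d)"
proof -
  obtain f where f: "f \<in> Aut_over N A" "map f a = b"
    using assms(1) by (auto simp: conj_over_def)
  have "map f d = d"
    using assms(2) Aut_overD(2)[OF f(1)] by (intro map_idI) blast
  with f show ?thesis
    by (auto simp: conj_over_def)
qed

text \<open>An automorphism fixing the appended tuple fixes each of its entries. Equal lengths allow
  the image of \<open>a @ d\<close> to be cut between \<open>b\<close> and \<open>d\<close>.\<close>

lemma conj_over_unappend:
  assumes "conj_over N A (a @ d) (b @ d)" "length a = length b"
  shows "conj_over N (A \<union> set d) a b"
proof -
  obtain f where f: "f \<in> Aut_over N A" "map f a = b" "map f d = d"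
    using assms by (auto simp: conj_over_def)
  then have "f \<in> Aut_over N (A \<union> set d)"
    by (auto simp: Aut_over_def map_eq_conv[of f d id, simplified])
  with f(2) show ?thesis
    by (auto simp: conj_over_def)
qed

section \<open>Countable models\<close>

locale aec =
  fixes \<K> :: "('s, 'a) kclass"
  assumes is_aec: "is_aec \<K>"
begin

lemma
  shows member_struct: "\<forall>A \<in> members \<K>. is_struct (voc \<K>) A"
    and strong_imp: "\<forall>A B. strong \<K> A B \<longrightarrow> A \<in> members \<K> \<and> B \<in> members \<K> \<and> substruct A B"
    and strong_refl: "\<forall>A \<in> members \<K>. strong \<K> A A"
    and strong_antisym: "\<forall>A B. strong \<K> A B \<longrightarrow> strong \<K> B A \<longrightarrow> A = B"
    and strong_trans_all: "\<forall>A B C. strong \<K> A B \<longrightarrow> strong \<K> B C \<longrightarrow> strong \<K> A C"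
    and strong_coherent:
      "\<forall>A B C. strong \<K> A C \<longrightarrow> strong \<K> B C \<longrightarrow> substruct A B \<longrightarrow> strong \<K> A B"
  using is_aec unfolding is_aec_def by - (elim conjE, assumption)+

lemma strong_trans: "strong \<K> A B \<Longrightarrow> strong \<K> B C \<Longrightarrow> strong \<K> A C"
  using strong_trans_all by metis

lemma strongD:
  assumes "strong \<K> A B"
  shows "A \<in> members \<K>" "B \<in> members \<K>" "substruct A B" "univ A \<subseteq> univ B"
    "is_struct (voc \<K>) A" "is_struct (voc \<K>) B"
proof -
  show *: "A \<in> members \<K>" "B \<in> members \<K>" "substruct A B"
    using strong_imp assms by metis+
  then show "univ A \<subseteq> univ B" "is_struct (voc \<K>) A" "is_struct (voc \<K>) B"
    by (simp_all add: substruct_def member_struct)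
qed

lemma strong_iso:
  assumes "strong \<K> A B" "is_struct (voc \<K>) A'" "is_struct (voc \<K>) B'" "iso f B B'" "iso f A A'"
  shows "strong \<K> A' B'"
proof -
  have "\<forall>A B A' B' f. strong \<K> A B \<longrightarrow> is_struct (voc \<K>) A' \<longrightarrow> is_struct (voc \<K>) B' \<longrightarrow>
        iso f B B' \<longrightarrow> iso f A A' \<longrightarrow> strong \<K> A' B'"
    using is_aec unfolding is_aec_def by (elim conjE) assumption
  with assms show ?thesis by blast
qed

text \<open>Both structures inherit their relations and functions from \<open>C\<close>, so
  inclusion of universes gives \<open>substruct\<close>, and the coherence axiom applies.\<close>

lemma strong_if_subset:
  assumes "strong \<K> A C" "strong \<K> B C" "univ A \<subseteq> univ B"
  shows "strong \<K> A B"
proof -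
  have "substruct A B"
    unfolding substruct_def
  proof (intro conjI allI ballI assms(3))
    fix s xs
    assume xs: "xs \<in> lists (univ A)"
    then have "xs \<in> lists (univ B)"
      using assms(3) lists_mono by blast
    with xs show "xs \<in> srel A s \<longleftrightarrow> xs \<in> srel B s" "sfun A s xs = sfun B s xs"
      using strongD(3)[OF assms(1)] strongD(3)[OF assms(2)] by (simp_all add: substruct_def)
  qed
  then show ?thesis
    using strong_coherent assms(1,2) by metis
qed

lemma strong_image_struct:
  assumes "strong \<K> A B" "is_struct (voc \<K>) B'" "iso f B B'"
  shows "strong \<K> (image_struct f A) B'" "iso f A (image_struct f A)"
proof -
  have "inj_on f (univ A)"
    using iso_bij[OF assms(3)] strongD(4)[OF assms(1)] by (auto simp: bij_betw_def intro: inj_on_subset)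
  note A = strongD(5)[OF assms(1)] this
  show "iso f A (image_struct f A)"
    by (rule iso_image_struct[OF A])
  then show "strong \<K> (image_struct f A) B'"
    by (rule strong_iso[OF assms(1) is_struct_image_struct[OF A] assms(2,3)])
qed

text \<open>The chain axiom wants a well-ordered set of structures, while the sequence may repeat
  members. So the axiom is applied to the range, ordered by \<open>strong\<close>.\<close>

lemma strong_chain_limit:
  fixes S :: "nat \<Rightarrow> ('s, 'a) fostruct"
  assumes step: "\<And>n. strong \<K> (S n) (S (Suc n))" and N: "\<And>n. strong \<K> (S n) N"
  obtains B where "strong \<K> B N" "univ B = (\<Union>n. univ (S n))"
proof -
  let ?C = "range S" let ?r = "{(A, B). A \<in> range S \<and> B \<in> range S \<and> strong \<K> A B}"
  have mono: "strong \<K> (S m) (S n)" if "m \<le> n" for m n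
    using that
  proof (induction rule: dec_induct)
    case base
    show ?case using strong_refl strongD(1)[OF step] by blast
  next
    case (step n)
    then show ?case using strong_trans assms(1) by blast
  qed
  \<comment> \<open>The index of the first occurrence maps the strict order on the range into the
    order of the naturals, which gives well-foundedness.\<close>
  define idx where "idx A = (LEAST n. S n = A)" for A
  have S_idx: "S (idx A) = A" if "A \<in> ?C" for A
    using that unfolding idx_def by (metis (mono_tags, lifting) LeastI imageE)
  have "?r - Id \<subseteq> inv_image less_than idx"
  proof (clarsimp simp: inv_image_def)
    fix m n
    assume *: "strong \<K> (S m) (S n)" "S m \<noteq> S n"
    show "idx (S m) < idx (S n)"
    proof (rule ccontr)
      assume "\<not> idx (S m) < idx (S n)"
      then have "strong \<K> (S n) (S m)"
        using mono[of "idx (S n)" "idx (S m)"] S_idx by simp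
      with * show False
        using strong_antisym by blast
    qed
  qed
  then have "wf (?r - Id)"
    using wf_subset by blast
  moreover have "linear_order_on ?C ?r"
  proof -
    have "refl_on ?C ?r"
      using mono by (auto simp: refl_on_def)
    moreover have "trans ?r"
      using strong_trans by (fastforce intro: transI)
    moreover have "antisym ?r"
      using strong_antisym by (fastforce intro: antisymI)
    moreover have "total_on ?C ?r"
    proof (rule total_onI)
      fix A B
      assume AB: "A \<in> ?C" "B \<in> ?C"
      then obtain m n where "A = S m" "B = S n" by blast
      with AB show "(A, B) \<in> ?r \<or> (B, A) \<in> ?r"
        using mono[of m n] mono[of n m] by (cases "m \<le> n") auto
    qed
    ultimately show ?thesis
      by (auto simp: order_on_defs)
  qed
  ultimately have "well_order_on ?C ?r"
    by (simp add: well_order_on_def)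
  moreover have "?C \<noteq> {}" "?C \<subseteq> members \<K>"
    using strongD(1)[OF N] by auto
  moreover have "\<forall>\<C>. \<C> \<noteq> {} \<longrightarrow> \<C> \<subseteq> members \<K> \<longrightarrow>
        well_order_on \<C> {(A, B). A \<in> \<C> \<and> B \<in> \<C> \<and> strong \<K> A B} \<longrightarrow>
        chain_union \<C> \<in> members \<K> \<and>
        (\<forall>A \<in> \<C>. strong \<K> A (chain_union \<C>)) \<and>
        (\<forall>B \<in> members \<K>. (\<forall>A \<in> \<C>. strong \<K> A B) \<longrightarrow> strong \<K> (chain_union \<C>) B)"
    using is_aec unfolding is_aec_def by (elim conjE) assumption
  ultimately have "strong \<K> (chain_union ?C) N"
    using N strongD(2)[OF N] by blast
  moreover have "univ (chain_union ?C) = (\<Union>n. univ (S n))"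
    by (simp add: chain_union_def)
  ultimately show ?thesis
    by (rule that)
qed

end

section \<open>Countable strong submodels closed under given operations\<close>

locale aec_LS = aec +
  assumes LS: "LS_omega \<K>"
begin

lemma countable_LS:
  assumes "A \<in> members \<K>" "X \<subseteq> univ A" "countable X"
  obtains B where "strong \<K> B A" "X \<subseteq> univ B" "countable (univ B)"
proof -
  obtain B where B: "strong \<K> B A" "X \<subseteq> univ B" "|univ B| \<le>o |X| +c natLeq"
    using LS assms(1,2) unfolding LS_omega_def by metis
  have "|X| +c natLeq =o natLeq"
    using assms(3) by (intro csum_absorb2[OF natLeq_Cinfinite]) (simp add: countable_card_le_natLeq)
  with B show ?thesis
    by (intro that) (auto simp: countable_card_le_natLeq intro: ordLeq_ordIso_trans)
qed

text \<open>Loewenheim-Skolem steps alternate with closing under \<open>\<Phi>\<close>, and the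
  limit of the resulting chain is taken. Closure passes to the limit because a finite set and a
  point already lie in one stage.\<close>

lemma closed_countable_model:
  assumes N: "N \<in> members \<K>"
    and \<Phi>: "\<And>A x. finite A \<Longrightarrow> A \<subseteq> univ N \<Longrightarrow> x \<in> univ N \<Longrightarrow> countable (\<Phi> A x) \<and> \<Phi> A x \<subseteq> univ N"
  obtains B where "strong \<K> B N" "countable (univ B)"
    "\<And>A x. finite A \<Longrightarrow> A \<subseteq> univ B \<Longrightarrow> x \<in> univ B \<Longrightarrow> \<Phi> A x \<subseteq> univ B"
proof -
  define Cl where "Cl X = X \<union> (\<Union>A \<in> {A. finite A \<and> A \<subseteq> X}. \<Union>x \<in> X. \<Phi> A x)" for X
  \<comment> \<open>A countable strong submodel is selected; the value matters only for countable
    subsets of \<open>univ N\<close>.\<close>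
  define L where "L X = (SOME B. strong \<K> B N \<and> X \<subseteq> univ B \<and> countable (univ B))" for X
  have L: "strong \<K> (L X) N \<and> X \<subseteq> univ (L X) \<and> countable (univ (L X))"
    if "countable X" "X \<subseteq> univ N" for X
    unfolding L_def by (rule someI_ex) (meson countable_LS N that)
  have Cl: "countable (Cl X)" "Cl X \<subseteq> univ N" if "countable X" "X \<subseteq> univ N" for X
  proof -
    show "Cl X \<subseteq> univ N"
      using that \<Phi> unfolding Cl_def by blast
    have "countable {A. finite A \<and> A \<subseteq> X}"
      using that(1) by (rule countable_Collect_finite_subset)
    then show "countable (Cl X)"
      using that \<Phi> unfolding Cl_def by (intro countable_Un countable_UN) blast+
  qed
  define S where "S = rec_nat (L {}) (\<lambda>_ B. L (Cl (univ B)))"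
  have S: "strong \<K> (S n) N \<and> countable (univ (S n))" for n
  proof (induction n)
    case 0
    show ?case using L[of "{}"] by (simp add: S_def)
  next
    case (Suc n)
    then show ?case
      using L[OF Cl] strongD(4) by (simp add: S_def)
  qed
  have Cl_sub: "Cl (univ (S n)) \<subseteq> univ (S (Suc n))" for n
    using L[OF Cl] S[of n] strongD(4) by (simp add: S_def)
  then have sub: "univ (S n) \<subseteq> univ (S (Suc n))" for n
    by (auto simp: Cl_def)
  have mono: "univ (S m) \<subseteq> univ (S n)" if "m \<le> n" for m n
    using that sub lift_Suc_mono_le[of "\<lambda>n. univ (S n)"] by blast
  have "strong \<K> (S n) (S (Suc n))" for n
    using S sub strong_if_subset by blast
  then obtain B where B: "strong \<K> B N" "univ B = (\<Union>n. univ (S n))"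
    using strong_chain_limit S by metis
  show ?thesis
  proof (rule that[OF B(1)])
    show "countable (univ B)"
      using S by (simp add: B(2))
    fix A x
    assume A: "finite A" "A \<subseteq> univ B" and x: "x \<in> univ B"
    then have "insert x A \<subseteq> (\<Union>n. univ (S n))"
      by (simp add: B(2))
    moreover have "subset.chain UNIV (range (\<lambda>n. univ (S n)))"
      unfolding subset_chain_def
    proof (intro conjI subset_UNIV ballI)
      fix X Y
      assume "X \<in> range (\<lambda>n. univ (S n))" "Y \<in> range (\<lambda>n. univ (S n))"
      then obtain m n where "X = univ (S m)" "Y = univ (S n)" by blast
      then show "X \<subseteq> Y \<or> Y \<subseteq> X"
        using mono[of m n] mono[of n m] by (cases "m \<le> n") simp_all
    qed
    ultimately obtain n where "insert x A \<subseteq> univ (S n)"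
      using finite_subset_Union_chain[of "insert x A" "range (\<lambda>n. univ (S n))"] A(1) by blast
    then have "\<Phi> A x \<subseteq> Cl (univ (S n))"
      unfolding Cl_def using A(1) by blast
    then show "\<Phi> A x \<subseteq> univ B"
      using Cl_sub B(2) by blast
  qed
qed

end

section \<open>The monster inside the supermonster\<close>

lemma countable_ordLess: "countable X \<Longrightarrow> natLeq <o r \<Longrightarrow> |X| <o r"
  by (meson countable_card_le_natLeq ordLeq_ordLess_trans)

locale monster_pair = aec_LS \<K> for \<K> :: "('s, 'a) kclass" +
  fixes \<delta> :: "'d rel" and M M' :: "('s, 'a) fostruct"
  assumes monster: "monster \<K> \<delta> M" and supermonster: "supermonster \<K> M M'"
    and infinite_member: "A \<in> members \<K> \<Longrightarrow> infinite (univ A)"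
begin

lemma M_strong: "strong \<K> M M'"
  using supermonster by (simp add: supermonster_def)

lemmas M_member = strongD(1)[OF M_strong] and M'_member = strongD(2)[OF M_strong]
  and M_sub = strongD(4)[OF M_strong]
  and M_struct = strongD(5)[OF M_strong] and M'_struct = strongD(6)[OF M_strong]

lemma M_lists: "a \<in> lists (univ M) \<Longrightarrow> a \<in> lists (univ M')"
  using M_sub lists_mono by blast

lemma homogeneous_M:
  assumes "strong \<K> A M" "strong \<K> B M" "countable (univ A)" "iso f A B"
  obtains g where "g \<in> Aut M" "\<And>x. x \<in> univ A \<Longrightarrow> g x = f x"
proof -
  have "univ B = f ` univ A"
    using iso_bij[OF assms(4)] by (simp add: bij_betw_def)
  then have "|univ A| <o \<delta>" "|univ B| <o \<delta>"
    using assms(3) monster by (simp_all add: monster_def countable_ordLess)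
  then show ?thesis
    using monster assms(1,2,4) that unfolding monster_def model_homogeneous_def by metis
qed

lemma homogeneous_M':
  assumes "strong \<K> A M'" "strong \<K> B M'" "countable (univ A)" "iso f A B"
  obtains g where "g \<in> Aut M'" "\<And>x. x \<in> univ A \<Longrightarrow> g x = f x"
proof -
  have "univ B = f ` univ A"
    using iso_bij[OF assms(4)] by (simp add: bij_betw_def)
  \<comment> \<open>Countable models are small in \<open>M'\<close> because \<open>univ M\<close> is
    infinite and of smaller cardinality than \<open>univ M'\<close>.\<close>
  moreover have "natLeq <o |univ M'|"
    using supermonster infinite_member[OF M_member] ordLeq_ordLess_trans infinite_iff_natLeq_ordLeq
    unfolding supermonster_def by blast
  ultimately have "|univ A| <o |univ M'|" "|univ B| <o |univ M'|"
    using assms(3) by (simp_all add: countable_ordLess)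
  then show ?thesis
    using supermonster assms(1,2,4) that unfolding supermonster_def model_homogeneous_def by metis
qed

lemma Aut_extend:
  assumes "f \<in> Aut M"
  obtains g where "g \<in> Aut M'" "\<And>x. x \<in> univ M \<Longrightarrow> g x = f x"
  using supermonster assms unfolding supermonster_def by metis

text \<open>Take countable models \<open>B\<close> containing \<open>X\<close> and \<open>C\<close>
  containing \<open>B\<close> and \<open>Y\<close>. Universality embeds \<open>C\<close> into
  \<open>M\<close>; the embedding is corrected to fix \<open>B\<close> and then extended to an
  automorphism of \<open>M'\<close> by homogeneity.\<close>

lemma move_into_M:
  assumes "X \<subseteq> univ M" "countable X" "Y \<subseteq> univ M'" "countable Y"
  obtains h where "h \<in> Aut_over M' X" "h ` Y \<subseteq> univ M"
proof -
  obtain B where B: "strong \<K> B M" "X \<subseteq> univ B" "countable (univ B)"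
    using countable_LS[OF M_member assms(1,2)] .
  have "univ B \<union> Y \<subseteq> univ M'" "countable (univ B \<union> Y)"
    using B strongD(4)[OF B(1)] M_sub assms by auto
  then obtain C where C: "strong \<K> C M'" "univ B \<union> Y \<subseteq> univ C" "countable (univ C)"
    using countable_LS[OF M'_member] by metis
  have BC: "strong \<K> B C"
    using strong_if_subset[OF strong_trans[OF B(1) M_strong] C(1)] C(2) by simp
  have "|univ C| <o \<delta>"
    using C(3) monster by (simp add: monster_def countable_ordLess)
  then obtain e C' where e: "iso e C C'" "strong \<K> C' M"
    using monster strongD(1)[OF C(1)] unfolding monster_def model_universal_def elem_emb_def by metis
  note eB = strong_image_struct[OF BC strongD(5)[OF e(2)] e(1)]
  \<comment> \<open>\<open>g\<close> agrees with the embedding on \<open>B\<close>, so following the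
    embedding by the inverse \<open>g'\<close> gives the identity on \<open>B\<close>, hence on
    \<open>X\<close>.\<close>
  obtain g where g: "g \<in> Aut M" "\<And>x. x \<in> univ B \<Longrightarrow> g x = e x"
    using homogeneous_M[OF B(1) strong_trans[OF eB(1) e(2)] B(3) eB(2)] by blast
  obtain g' where g': "g' \<in> Aut M" "\<And>x. x \<in> univ M \<Longrightarrow> g' (g x) = x"
    using Aut_inverse[OF M_struct g(1)] by metis
  have "iso g' M M"
    using g'(1) by (simp add: Aut_def)
  note gC = strong_image_struct[OF e(2) M_struct this]
  obtain h where h: "h \<in> Aut M'" "\<And>x. x \<in> univ C \<Longrightarrow> h x = (g' \<circ> e) x"
    using homogeneous_M'[OF C(1) strong_trans[OF gC(1) M_strong] C(3) iso_comp[OF e(1) gC(2)]] by blast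
  show ?thesis
  proof
    show "h \<in> Aut_over M' X"
    proof (rule Aut_overI[OF h(1)])
      fix x assume "x \<in> X"
      then have x: "x \<in> univ B" "x \<in> univ C" "x \<in> univ M"
        using B(2) C(2) assms(1) by auto
      then show "h x = x"
        using h(2)[OF x(2)] g(2)[OF x(1)] g'(2)[OF x(3)] by simp
    qed
    show "h ` Y \<subseteq> univ M"
    proof (rule image_subsetI)
      fix y assume "y \<in> Y"
      then have y: "y \<in> univ C"
        using C(2) by blast
      then have "e y \<in> univ M"
        using iso_bij[OF e(1)] strongD(4)[OF e(2)] by (auto simp: bij_betw_def)
      then show "h y \<in> univ M"
        using h(2)[OF y] Aut_bij[OF g'(1)] by (auto simp: bij_betw_def)
    qed
  qed
qed

text \<open>Automorphisms of \<open>M\<close> extend to \<open>M'\<close>, which gives one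
  direction. For the other, the image of a countable model around \<open>X\<close> and
  \<open>x\<close> is brought back into \<open>M\<close>, where homogeneity applies.\<close>

lemma conj_over_M'_iff:
  assumes "X \<subseteq> univ M" "countable X" "x \<in> lists (univ M)" "y \<in> lists (univ M)"
  shows "conj_over M' X x y \<longleftrightarrow> conj_over M X x y"
proof
  assume "conj_over M X x y"
  then obtain f where f: "f \<in> Aut_over M X" "map f x = y"
    by (auto simp: conj_over_def)
  obtain g where g: "g \<in> Aut M'" "\<And>x. x \<in> univ M \<Longrightarrow> g x = f x"
    using Aut_extend[OF Aut_overD(1)[OF f(1)]] by blast
  have "g \<in> Aut_over M' X"
    using g assms(1) Aut_overD(2)[OF f(1)] by (intro Aut_overI) auto
  moreover have "map g x = y"
    unfolding f(2)[symmetric] using g(2) assms(3) by (auto simp: in_lists_conv_set)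
  ultimately show "conj_over M' X x y"
    by (auto simp: conj_over_def)
next
  assume "conj_over M' X x y"
  then obtain f where f: "f \<in> Aut_over M' X" "map f x = y"
    by (auto simp: conj_over_def)
  have "X \<union> set x \<subseteq> univ M" "countable (X \<union> set x)"
    using assms by (auto simp: in_lists_conv_set countable_finite)
  then obtain D where D: "strong \<K> D M" "X \<union> set x \<subseteq> univ D" "countable (univ D)"
    using countable_LS[OF M_member] by metis
  have DM': "univ D \<subseteq> univ M'"
    using strongD(4)[OF D(1)] M_sub by blast
  have "X \<union> set y \<subseteq> univ M" "countable (X \<union> set y)"
    using assms by (auto simp: in_lists_conv_set countable_finite)
  moreover have "f ` univ D \<subseteq> univ M'" "countable (f ` univ D)"
    using Aut_image_subset[OF Aut_overD(1)[OF f(1)] DM'] D(3) by auto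
  \<comment> \<open>\<open>f\<close> may throw \<open>D\<close> out of \<open>M\<close>;
    \<open>h\<close> brings its image back without moving \<open>X\<close> or the entries of
    \<open>y\<close>.\<close>
  ultimately obtain h where h: "h \<in> Aut_over M' (X \<union> set y)" "h ` f ` univ D \<subseteq> univ M"
    using move_into_M by metis
  have hf: "iso (h \<circ> f) M' M'"
    using Aut_comp[OF Aut_overD(1)[OF f(1)] Aut_overD(1)[OF h(1)]] by (simp add: Aut_def)
  note im = strong_image_struct[OF strong_trans[OF D(1) M_strong] M'_struct hf]
  have "strong \<K> (image_struct (h \<circ> f) D) M"
    using strong_if_subset[OF im(1) M_strong] h(2) by (simp add: image_comp)
  then obtain g where g: "g \<in> Aut M" "\<And>z. z \<in> univ D \<Longrightarrow> g z = (h \<circ> f) z"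
    using homogeneous_M[OF D(1) _ D(3) im(2)] by metis
  have "g z = z" if "z \<in> X" for z
    using that g(2)[of z] D(2) Aut_overD(2)[OF f(1)] Aut_overD(2)[OF h(1)] by auto
  then have "g \<in> Aut_over M X"
    using g(1) by (intro Aut_overI)
  moreover have "map g x = map h (map f x)"
    using g(2) D(2) by auto
  then have "map g x = y"
    unfolding f(2) using Aut_overD(2)[OF h(1)] by (simp add: map_idI)
  ultimately show "conj_over M X x y"
    by (auto simp: conj_over_def)
qed

text \<open>This is saturation of \<open>M\<close> over countable sets: \<open>move_into_M\<close>
  is applied to the entries of \<open>b\<close>.\<close>

lemma realized_in_M:
  assumes "X \<subseteq> univ M" "countable X" "b \<in> lists (univ M')"
  obtains b' where "b' \<in> lists (univ M)" "conj_over M' X b b'"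
proof -
  have "set b \<subseteq> univ M'" "countable (set b)"
    using assms(3) by (auto simp: countable_finite)
  then obtain h where h: "h \<in> Aut_over M' X" "h ` set b \<subseteq> univ M"
    using move_into_M[OF assms(1,2)] by metis
  show ?thesis
  proof (rule that)
    show "map h b \<in> lists (univ M)"
      using h(2) by auto
    show "conj_over M' X b (map h b)"
      using h(1) by (auto simp: conj_over_def)
  qed
qed

end

section \<open>Non-splitting over a finite set\<close>

text \<open>
  Moving the current tuple by an automorphism that preserves \<open>\<A>\<close> keeps it splitting over every
  finite subset of \<open>\<A>\<close>, so player I is never stuck.
\<close>

lemma not_gi_II_wins_if_splits:
  assumes M: "is_struct V M" and \<A>: "univ \<A> \<subseteq> univ M" and b: "b \<in> lists (univ M)"
    and split: "\<And>A. finite A \<Longrightarrow> A \<subseteq> univ \<A> \<Longrightarrow>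
      \<exists>c \<in> lists (univ \<A>). \<exists>f \<in> Aut_over M A. f ` univ \<A> = univ \<A> \<and> map f c \<in> lists (univ \<A>) \<and>
        \<not> conj_over M A (b @ c) (b @ map f c)"
  shows "\<not> gi_II_wins M \<A> b {} n"
proof
  assume "gi_II_wins M \<A> b {} n"
  then obtain \<sigma> where
    legal: "\<And>ms c C B. gi_play M \<A> b {} \<sigma> (ms @ [(c, C)]) c B \<Longrightarrow> finite B \<and> B \<subseteq> univ \<A> \<and> C \<subseteq> B"
    and short: "\<And>ms c B. gi_play M \<A> b {} \<sigma> ms c B \<Longrightarrow> length ms \<le> n"
    unfolding gi_II_wins_def by metis
  \<comment> \<open>Invariant after \<open>k\<close> rounds: the current tuple is the image of
    \<open>b\<close> under an automorphism \<open>g\<close> of \<open>M\<close> that maps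
    \<open>univ \<A>\<close> onto itself.\<close>
  have "\<exists>ms g B. gi_play M \<A> b {} \<sigma> ms (map g b) B \<and> length ms = k \<and> finite B \<and> B \<subseteq> univ \<A> \<and>
      g \<in> Aut M \<and> g ` univ \<A> = univ \<A>" for k
  proof (induction k)
    case 0
    have "(\<lambda>x. x) \<in> Aut M"
      by (simp add: Aut_def iso_def option.map_ident bij_betw_def)
    moreover have "gi_play M \<A> b {} \<sigma> [] (map (\<lambda>x. x) b) {}"
      by (simp add: gi_start)
    ultimately show ?case
      by (intro exI[of _ "[]"] exI[of _ "\<lambda>x. x"] exI[of _ "{}"]) auto
  next
    case (Suc k)
    then obtain ms g B where play: "gi_play M \<A> b {} \<sigma> ms (map g b) B" "length ms = k"
      and B: "finite B" "B \<subseteq> univ \<A>" and g: "g \<in> Aut M" "g ` univ \<A> = univ \<A>"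
      by metis
    \<comment> \<open>The hypothesis concerns \<open>b\<close> and not its image under
      \<open>g\<close>, so the finite set \<open>B\<close> is pulled back by the inverse
      \<open>h\<close> of \<open>g\<close>.\<close>
    obtain h where h: "h \<in> Aut M" "\<And>x. x \<in> univ M \<Longrightarrow> h (g x) = x" "\<And>x. x \<in> univ M \<Longrightarrow> g (h x) = x"
      using Aut_inverse[OF M g(1)] by metis
    have "h x \<in> univ \<A>" if "x \<in> univ \<A>" for x
    proof -
      have "x \<in> g ` univ \<A>"
        using that by (simp add: g(2))
      then obtain y where "y \<in> univ \<A>" "x = g y"
        by blast
      then show ?thesis
        using h(2)[of y] \<A> by auto
    qed
    then have hB: "finite (h ` B)" "h ` B \<subseteq> univ \<A>"
      using B by auto
    have "(g \<circ> h) ` B = id ` B"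
      using B(2) \<A> h(3) by (intro image_cong) auto
    then have ghB: "g ` h ` B = B"
      by (simp add: image_comp)
    obtain c f where c: "c \<in> lists (univ \<A>)"
      and f: "f \<in> Aut_over M (h ` B)" "f ` univ \<A> = univ \<A>" "map f c \<in> lists (univ \<A>)"
      and nconj: "\<not> conj_over M (h ` B) (b @ c) (b @ map f c)"
      using split[OF hB] by metis
    define d where "d = map f c"
    \<comment> \<open>Player I will move to \<open>map g (map f b)\<close>; adding the entries of
      \<open>map g d\<close> to the set makes the change of type visible.\<close>
    define C where "C = B \<union> set (map g d)"
    have fA: "f \<in> Aut M"
      by (rule Aut_overD(1)[OF f(1)])
    have dM: "d \<in> lists (univ M)" "c \<in> lists (univ M)"
      using f(3) c \<A> by (auto simp: d_def in_lists_conv_set)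
    have BM: "B \<subseteq> univ M" "h ` B \<subseteq> univ M"
      using B hB \<A> by auto
    have gdA: "set (map g d) \<subseteq> univ \<A>"
      using f(3) g(2) by (auto simp: d_def in_lists_conv_set)
    have lists: "map f b \<in> lists (univ M)" "map g b \<in> lists (univ M)" "map g (map f b) \<in> lists (univ M)"
      using b Aut_lists fA g(1) by metis+
    have C: "finite C" "C \<subseteq> univ \<A>" "B \<subseteq> C" "C \<subseteq> univ M"
      using B gdA \<A> by (auto simp: C_def)
    have fb: "conj_over M (h ` B) (b @ c) (map f b @ d)"
      using f(1) by (auto simp: conj_over_def d_def)
    have "conj_over M (h ` B) b (map f b)"
      using f(1) by (auto simp: conj_over_def)
    from conj_over_image[OF M BM(2) b g(1) this]
    have same: "wtp M B (map g (map f b)) = wtp M B (map g b)"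
      unfolding ghB using wtp_eq_iff[OF M B(1) BM(1) lists(2,3)] by simp
    \<comment> \<open>If the types agreed over \<open>C\<close>, appending \<open>map g d\<close>
      and applying \<open>h\<close> would make \<open>map f b @ d\<close> and \<open>b @ d\<close>
      conjugate over the pulled-back set. But \<open>f\<close> conjugates \<open>b @ c\<close> to
      \<open>map f b @ d\<close>, contradicting \<open>nconj\<close>.\<close>
    have differ: "wtp M C (map g (map f b)) \<noteq> wtp M C (map g b)"
    proof
      assume "wtp M C (map g (map f b)) = wtp M C (map g b)"
      then have "conj_over M C (map g (map f b)) (map g b)"
        using wtp_eq_iff[OF M C(1,4) lists(3,2)] by simp
      then have "conj_over M C (map g (map f b) @ map g d) (map g b @ map g d)"
        by (rule conj_over_append) (simp add: C_def)
      then have "conj_over M B (map g (map f b @ d)) (map g (b @ d))"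
        using conj_over_mono[OF C(3)] by simp
      moreover have "map g (map f b @ d) \<in> lists (univ M)"
        using lists(3) dM(1) Aut_lists[OF g(1), of d] by simp
      ultimately have "conj_over M (h ` B) (map h (map g (map f b @ d))) (map h (map g (b @ d)))"
        by (intro conj_over_image[OF M BM(1) _ h(1)])
      moreover have "map h (map g x) = x" if "x \<in> lists (univ M)" for x
        using that h(2) by (induction x) auto
      from this[of "map f b @ d"] this[of "b @ d"]
      have "map h (map g (map f b @ d)) = map f b @ d" "map h (map g (b @ d)) = b @ d"
        using lists(1) dM(1) b by (simp_all del: map_append map_map)
      ultimately have "conj_over M (h ` B) (map f b @ d) (b @ d)"
        by (simp only:)
      with fb nconj conj_over_trans show False
        unfolding d_def by blast
    qed
    have "gi_move M \<A> (map g b) B (map g (map f b)) C"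
      using lists(3) C same differ by (simp add: gi_move_def)
    from gi_step[OF play(1) this]
    have next_play: "gi_play M \<A> b {} \<sigma> (ms @ [(map (g \<circ> f) b, C)]) (map (g \<circ> f) b)
        (\<sigma> (ms @ [(map (g \<circ> f) b, C)]))"
      by simp
    moreover have "(g \<circ> f) ` univ \<A> = univ \<A>"
      unfolding image_comp[symmetric] f(2) g(2) ..
    moreover note Aut_comp[OF fA g(1)]
    ultimately show ?case
      using legal[OF next_play] play(2) by (metis length_append_singleton)
  qed
  \<comment> \<open>A play of length \<open>Suc n\<close> exceeds the bound \<open>n\<close>
    guaranteed by the strategy.\<close>
  from this[of "Suc n"] short show False
    by fastforce
qed

section \<open>Non-splitting from the game axiom\<close>

context monster_pair
begin

lemma not_splits_finite:
  assumes AIV: "axiom_AIV \<K> \<delta> M" and b: "b \<in> lists (univ M')"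
  obtains a where "a \<in> lists (univ M)" "\<not> splits M' b (univ M) (set a)"
proof -
  have False if all_split: "\<And>a. a \<in> lists (univ M) \<Longrightarrow> splits M' b (univ M) (set a)"
  proof -
    let ?fin = "{A. finite A \<and> A \<subseteq> univ M}"
    \<comment> \<open>Splitting over \<open>A\<close> yields two tuples of equal type over
      \<open>A\<close>. They are linked by an automorphism \<open>f\<close> of \<open>M\<close>, and
      a right inverse \<open>g\<close> is recorded so that \<open>f\<close> can later be made onto a
      countable model.\<close>
    have "\<forall>A \<in> ?fin. \<exists>c f g. c \<in> lists (univ M) \<and> f \<in> Aut_over M A \<and>
        \<not> conj_over M' A (b @ c) (b @ map f c) \<and> g \<in> Aut M \<and> (\<forall>x \<in> univ M. f (g x) = x)"
    proof
      fix A assume "A \<in> ?fin"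
      then have A: "finite A" "A \<subseteq> univ M"
        by simp_all
      obtain a where a: "set a = A"
        using finite_list[OF A(1)] by blast
      then have "a \<in> lists (univ M)"
        using A(2) by (simp add: in_lists_conv_set subset_iff)
      from all_split[OF this] obtain c d where cd: "c \<in> lists (univ M)" "d \<in> lists (univ M)"
        and eq: "wtp M' A c = wtp M' A d" and neq: "wtp M' A (b @ c) \<noteq> wtp M' A (b @ d)"
        unfolding splits_def a by blast
      have AM': "A \<subseteq> univ M'"
        using A(2) M_sub by blast
      \<comment> \<open>Equality of types is computed in \<open>M'\<close>, but the witness has to
        be an automorphism of \<open>M\<close>; hence the passage through
        \<open>conj_over_M'_iff\<close>.\<close>
      have "conj_over M A c d"
        using eq wtp_eq_iff[OF M'_struct A(1) AM' M_lists M_lists] cd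
          conj_over_M'_iff[OF A(2) countable_finite[OF A(1)]] by simp
      then obtain f where f: "f \<in> Aut_over M A" "map f c = d"
        by (auto simp: conj_over_def)
      have "\<not> conj_over M' A (b @ c) (b @ map f c)"
        using neq wtp_eq_iff[OF M'_struct A(1) AM', of "b @ c" "b @ d"] b cd[THEN M_lists] f(2) by simp
      moreover obtain g where "g \<in> Aut M" "\<And>x. x \<in> univ M \<Longrightarrow> f (g x) = x"
        using Aut_inverse[OF M_struct Aut_overD(1)[OF f(1)]] by metis
      ultimately show "\<exists>c f g. c \<in> lists (univ M) \<and> f \<in> Aut_over M A \<and>
          \<not> conj_over M' A (b @ c) (b @ map f c) \<and> g \<in> Aut M \<and> (\<forall>x \<in> univ M. f (g x) = x)"
        using cd(1) f(1) by blast
    qed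
    then obtain c F G where cFG: "\<forall>A \<in> ?fin. c A \<in> lists (univ M) \<and> F A \<in> Aut_over M A \<and>
        \<not> conj_over M' A (b @ c A) (b @ map (F A) (c A)) \<and> G A \<in> Aut M \<and>
        (\<forall>x \<in> univ M. F A (G A x) = x)"
      unfolding bchoice_iff by (elim exE) (rule that)
    have c: "c A \<in> lists (univ M)" and F: "F A \<in> Aut_over M A" and G: "G A \<in> Aut M"
      and nconj: "\<not> conj_over M' A (b @ c A) (b @ map (F A) (c A))"
      and FG: "x \<in> univ M \<Longrightarrow> F A (G A x) = x"
      if "finite A" "A \<subseteq> univ M" for A x
      using cFG that by simp_all
    \<comment> \<open>A set closed under \<open>\<Phi>\<close> is preserved by \<open>F A\<close>
      and \<open>G A\<close> for each of its finite subsets \<open>A\<close>, and contains the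
      entries of \<open>c A\<close> as soon as it is nonempty.\<close>
    define \<Phi> where "\<Phi> A x = insert (F A x) (insert (G A x) (set (c A)))" for A x
    have \<Phi>: "countable (\<Phi> A x) \<and> \<Phi> A x \<subseteq> univ M"
      if "finite A" "A \<subseteq> univ M" "x \<in> univ M" for A x
      using c[OF that(1,2)] Aut_bij[OF Aut_overD(1)[OF F[OF that(1,2)]]] Aut_bij[OF G[OF that(1,2)]] that(3)
      by (auto simp: \<Phi>_def countable_finite bij_betw_def in_lists_conv_set)
    obtain \<A> where \<A>: "strong \<K> \<A> M" "countable (univ \<A>)"
      and closed: "\<And>A x. finite A \<Longrightarrow> A \<subseteq> univ \<A> \<Longrightarrow> x \<in> univ \<A> \<Longrightarrow> \<Phi> A x \<subseteq> univ \<A>"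
      using closed_countable_model[of M \<Phi>, OF M_member \<Phi>] by blast
    note sub = strongD(4)[OF \<A>(1)]
    \<comment> \<open>The game axiom concerns tuples of \<open>M\<close>, so \<open>b\<close> is
      replaced by a tuple of \<open>M\<close> conjugate to it over the countable model.\<close>
    obtain b' where b': "b' \<in> lists (univ M)" "conj_over M' (univ \<A>) b b'"
      using realized_in_M[OF sub \<A>(2) b] .
    have \<A>M': "univ \<A> \<subseteq> univ M'"
      using sub M_sub by blast
    have b'b: "conj_over M' (univ \<A>) b' b"
      by (rule conj_over_sym[OF M'_struct \<A>M' b b'(2)])
    have "\<exists>c \<in> lists (univ \<A>). \<exists>f \<in> Aut_over M A. f ` univ \<A> = univ \<A> \<and> map f c \<in> lists (univ \<A>) \<and>
        \<not> conj_over M A (b' @ c) (b' @ map f c)" if A: "finite A" "A \<subseteq> univ \<A>" for A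
    proof (intro bexI conjI)
      have AM: "A \<subseteq> univ M"
        using A(2) sub by blast
      show "F A \<in> Aut_over M A"
        by (rule F[OF A(1) AM])
      have "univ \<A> \<noteq> {}"
        using infinite_member[OF strongD(1)[OF \<A>(1)]] by auto
      then obtain x where "x \<in> univ \<A>"
        by blast
      then have "set (c A) \<subseteq> univ \<A>"
        using closed[OF A] by (auto simp: \<Phi>_def)
      then show cA: "c A \<in> lists (univ \<A>)"
        by (simp add: in_lists_conv_set subset_iff)
      have *: "F A x \<in> univ \<A>" "G A x \<in> univ \<A>" if "x \<in> univ \<A>" for x
        using closed[OF A that] by (auto simp: \<Phi>_def)
      show "F A ` univ \<A> = univ \<A>"
      proof (intro equalityI subsetI)
        fix x assume x: "x \<in> univ \<A>"
        then have "x = F A (G A x)"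
          using FG[OF A(1) AM subsetD[OF sub x]] by simp
        then show "x \<in> F A ` univ \<A>"
          using *(2)[OF x] by (rule image_eqI)
      qed (use * in auto)
      show FcA: "map (F A) (c A) \<in> lists (univ \<A>)"
        using cA *(1) by (auto simp: in_lists_conv_set)
      \<comment> \<open>\<open>c A\<close> and its image lie in the model over which
        \<open>b\<close> and \<open>b'\<close> are conjugate, so the failure of conjugacy passes
        from \<open>b\<close> to \<open>b'\<close>.\<close>
      show "\<not> conj_over M A (b' @ c A) (b' @ map (F A) (c A))"
      proof
        assume "conj_over M A (b' @ c A) (b' @ map (F A) (c A))"
        then have 1: "conj_over M' A (b' @ c A) (b' @ map (F A) (c A))"
          using conj_over_M'_iff[OF AM countable_finite[OF A(1)], of "b' @ c A" "b' @ map (F A) (c A)"]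
            b'(1) cA FcA sub by (auto simp: in_lists_conv_set)
        have 2: "conj_over M' A (b @ c A) (b' @ c A)"
          using conj_over_mono[OF A(2) conj_over_append[OF b'(2)]] cA by (auto simp: in_lists_conv_set)
        have 3: "conj_over M' A (b' @ map (F A) (c A)) (b @ map (F A) (c A))"
          using FcA by (intro conj_over_mono[OF A(2) conj_over_append[OF b'b]])
            (auto simp: in_lists_conv_set)
        show False
          using nconj[OF A(1) AM] conj_over_trans[OF conj_over_trans[OF 2 1] 3] by simp
      qed
    qed
    then have "\<not> gi_II_wins M \<A> b' {} n" for n
      by (rule not_gi_II_wins_if_splits[OF M_struct sub b'(1)])
    moreover have "is_model \<K> \<delta> M \<A>"
      using \<A> strongD(1)[OF \<A>(1)] monster by (simp add: is_model_def monster_def countable_ordLess)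
    \<comment> \<open>The axiom bounds the number of rounds in terms of \<open>b'\<close> alone; for
      this model and the empty initial set every bound has been refuted.\<close>
    ultimately show False
      using AIV b'(1) \<A>(2) unfolding axiom_AIV_def by (meson empty_subsetI finite.emptyI)
  qed
  then show ?thesis
    using that by blast
qed

end

section \<open>Automorphisms of the structure of imaginaries\<close>

locale imaginary_sorts =
  fixes V :: "'s vocab" and M :: "('s, 'a) fostruct" and \<E> :: "'a list rel set"
  assumes struct: "is_struct V M" and equality_in: "equality_rel M \<in> \<E>"
    and Field_sub: "E \<in> \<E> \<Longrightarrow> Field E \<subseteq> lists (univ M)"
begin

lemma home_eq: "x \<in> univ M \<Longrightarrow> home M x = (equality_rel M, {[x]})"
  by (auto simp: home_def imag_def equality_rel_def tuples_def Id_on_def)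

lemma inj_home: "inj_on (home M) (univ M)"
  by (rule inj_onI) (simp add: home_eq)

lemma unhome_home: "x \<in> univ M \<Longrightarrow> unhome M (home M x) = x"
  unfolding unhome_def by (rule the_inv_into_f_f[OF inj_home])

lemma Field_equality: "Field (equality_rel M) = (\<lambda>x. [x]) ` univ M"
proof -
  have "Field (equality_rel M) = tuples M 1"
    by (auto simp: equality_rel_def Field_def)
  also have "\<dots> = (\<lambda>x. [x]) ` univ M"
    by (auto simp: tuples_def length_Suc_conv)
  finally show ?thesis .
qed

lemma home_in: "x \<in> univ M \<Longrightarrow> home M x \<in> univ (Meq M \<E>)"
  unfolding Meq_def home_def fostruct.simps mem_Collect_eq
  using equality_in Field_equality by (metis imageI)

lemma map_unhome_home: "a \<in> lists (univ M) \<Longrightarrow> map (unhome M) (map (home M) a) = a"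
  using unhome_home by (induction a) auto

lemma map_home_in: "a \<in> lists (univ M) \<Longrightarrow> map (home M) a \<in> lists (home M ` univ M)"
  by (auto simp: in_lists_conv_set)

text \<open>The home sort is named by a relation symbol, so automorphisms of
  \<open>Meq M \<E>\<close> preserve it in both directions, as \<open>f_home_iff\<close>
  records.\<close>

lemma srel_equality: "[\<alpha>] \<in> srel (Meq M \<E>) (Inr (equality_rel M)) \<longleftrightarrow> \<alpha> \<in> home M ` univ M"
  using equality_in by (auto simp: Meq_def home_def Field_equality)

lemma srel_Inl:
  assumes "a \<in> lists (univ M)"
  shows "map (home M) a \<in> srel (Meq M \<E>) (Inl s) \<longleftrightarrow> a \<in> srel M s"
proof
  assume "map (home M) a \<in> srel (Meq M \<E>) (Inl s)"
  then obtain a' where a': "a' \<in> srel M s" "map (home M) a = map (home M) a'"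
    by (auto simp: Meq_def)
  moreover have "srel M s \<subseteq> lists (univ M)"
    using struct by (auto simp: is_struct_def)
  ultimately show "a \<in> srel M s"
    using map_inj_lists_eq_iff[OF inj_home assms] by blast
qed (simp add: Meq_def)

lemma sfun_Inl:
  assumes "a \<in> lists (univ M)"
  shows "sfun (Meq M \<E>) (Inl s) (map (home M) a) = map_option (home M) (sfun M s a)"
  using map_home_in[OF assms] map_unhome_home[OF assms] by (simp add: Meq_def del: map_map)

lemma sfun_Inr:
  assumes "a \<in> lists (univ M)"
  shows "sfun (Meq M \<E>) (Inr E) (map (home M) a) =
    (if E \<in> \<E> \<and> a \<in> Field E then Some (imag E a) else None)"
  using map_home_in[OF assms] map_unhome_home[OF assms] by (simp add: Meq_def del: map_map)

section \<open>The action of an automorphism of the imaginaries on the home sort\<close>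

context
  fixes f
  assumes f: "f \<in> Aut (Meq M \<E>)"
begin

abbreviation base_map where
  "base_map \<equiv> (\<lambda>x. unhome M (f (home M x)))"

lemma iso_f: "iso f (Meq M \<E>) (Meq M \<E>)"
  using f by (simp add: Aut_def)

lemma f_home_iff:
  assumes "\<alpha> \<in> univ (Meq M \<E>)"
  shows "f \<alpha> \<in> home M ` univ M \<longleftrightarrow> \<alpha> \<in> home M ` univ M"
  using iso_rel[OF iso_f, of "[\<alpha>]" "Inr (equality_rel M)"] assms by (simp add: srel_equality)

lemma f_home:
  assumes "x \<in> univ M"
  shows "base_map x \<in> univ M" "f (home M x) = home M (base_map x)"
proof -
  obtain y where "y \<in> univ M" "f (home M x) = home M y"
    using f_home_iff[OF home_in[OF assms]] assms by blast
  then show "base_map x \<in> univ M" "f (home M x) = home M (base_map x)"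
    by (simp_all add: unhome_home)
qed

lemma map_base_map_in: "a \<in> lists (univ M) \<Longrightarrow> map base_map a \<in> lists (univ M)"
  using f_home(1) by (auto simp: in_lists_conv_set)

lemma map_f_home: "a \<in> lists (univ M) \<Longrightarrow> map f (map (home M) a) = map (home M) (map base_map a)"
  using f_home(2) by (auto simp: in_lists_conv_set)

lemma map_home_Meq: "a \<in> lists (univ M) \<Longrightarrow> map (home M) a \<in> lists (univ (Meq M \<E>))"
  using home_in by (auto simp: in_lists_conv_set)

text \<open>The symbols \<open>Inl s\<close> carry the structure of \<open>M\<close> on the home
  sort. Surjectivity holds because a preimage of a home element is a home element, by
  \<open>f_home_iff\<close>.\<close>

lemma base_map_Aut: "base_map \<in> Aut M"
proof -
  have bij_f: "bij_betw f (univ (Meq M \<E>)) (univ (Meq M \<E>))"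
    by (rule iso_bij[OF iso_f])
  have "bij_betw base_map (univ M) (univ M)"
    unfolding bij_betw_def
  proof
    show "inj_on base_map (univ M)"
    proof (rule inj_onI)
      fix x y assume xy: "x \<in> univ M" "y \<in> univ M" "base_map x = base_map y"
      then have "f (home M x) = f (home M y)"
        using f_home(2) by metis
      then have "home M x = home M y"
        using bij_f home_in xy(1,2) by (auto simp: bij_betw_def dest: inj_onD)
      then show "x = y"
        using inj_home xy(1,2) by (auto dest: inj_onD)
    qed
    show "base_map ` univ M = univ M"
    proof (intro equalityI subsetI)
      fix y assume y: "y \<in> univ M"
      then have "home M y \<in> f ` univ (Meq M \<E>)"
        using bij_f home_in by (simp add: bij_betw_def)
      then obtain \<alpha> where \<alpha>: "\<alpha> \<in> univ (Meq M \<E>)" "home M y = f \<alpha>"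
        by blast
      then obtain x where x: "x \<in> univ M" "\<alpha> = home M x"
        using f_home_iff[OF \<alpha>(1)] y imageI[of y "univ M" "home M"] by auto
      have "y = base_map x"
        using \<alpha>(2) x(2) unhome_home[OF y] by simp
      then show "y \<in> base_map ` univ M"
        using x(1) by (rule image_eqI)
    qed (use f_home(1) in auto)
  qed
  moreover have "map base_map a \<in> srel M s \<longleftrightarrow> a \<in> srel M s"
    if a: "a \<in> lists (univ M)" for a s
    using iso_rel[OF iso_f map_home_Meq[OF a], of "Inl s"]
    unfolding map_f_home[OF a] srel_Inl[OF a] srel_Inl[OF map_base_map_in[OF a]] .
  moreover have "map_option base_map (sfun M s a) = sfun M s (map base_map a)"
    if a: "a \<in> lists (univ M)" for a s
  proof -
    have *: "map_option (home M) (sfun M s (map base_map a)) =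
        map_option f (map_option (home M) (sfun M s a))"
      using iso_fun[OF iso_f map_home_Meq[OF a], of "Inl s"]
      unfolding map_f_home[OF a] sfun_Inl[OF a] sfun_Inl[OF map_base_map_in[OF a]] .
    \<comment> \<open>Function values stay in \<open>univ M\<close>, so \<open>unhome M\<close>
      cancels \<open>home M\<close> on them.\<close>
    have dom: "y \<in> univ M" if "sfun M s xs = Some y" for xs y
      using struct that unfolding is_struct_def by metis
    have "sfun M s (map base_map a) = map_option (unhome M) (map_option (home M) (sfun M s (map base_map a)))"
      using dom unhome_home by (cases "sfun M s (map base_map a)") auto
    then show ?thesis
      unfolding * by (simp add: option.map_comp comp_def)
  qed
  ultimately show ?thesis
    by (simp add: Aut_def iso_def)
qed

text \<open>The function symbol \<open>Inr E\<close> sends the home copy of \<open>a\<close> to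
  \<open>imag E a\<close>, and \<open>f\<close> commutes with it. So the action on the home sort
  decides the action on every sort.\<close>

lemma f_imag:
  assumes E: "E \<in> \<E>" and a: "a \<in> Field E"
  shows "f (imag E a) = imag E (map base_map a)"
proof -
  have aM: "a \<in> lists (univ M)"
    using Field_sub E a by blast
  have "sfun (Meq M \<E>) (Inr E) (map (home M) (map base_map a)) = Some (f (imag E a))"
    using iso_fun[OF iso_f map_home_Meq[OF aM], of "Inr E"] E a
    unfolding map_f_home[OF aM] sfun_Inr[OF aM] by simp
  \<comment> \<open>The value is \<open>Some\<close>, which rules out the undefined branch and puts
    the image tuple into \<open>Field E\<close>.\<close>
  then show ?thesis
    unfolding sfun_Inr[OF map_base_map_in[OF aM]] by (simp split: if_splits)
qed

end

end

section \<open>Canonical bases\<close>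

lemma conj_over_empty_Aut_iff:
  assumes "is_struct V N" "y \<in> lists (univ N)" "g \<in> Aut N"
  shows "conj_over N {} x (map g y) \<longleftrightarrow> conj_over N {} x y"
proof -
  have "conj_over N {} y (map g y)"
    using assms(3) by (auto simp: conj_over_def Aut_over_def)
  then show ?thesis
    using conj_over_trans conj_over_sym[OF assms(1) _ assms(2)] by blast
qed

lemma equiv_defining_rel: "equiv (tuples M n) (defining_rel M n q)"
  by (intro equivI refl_onI symI transI) (auto simp: defining_rel_def)

context monster_pair
begin

text \<open>A single tuple realizes all members of the family, and a Galois type is the orbit of any
  of its realizations.\<close>

lemma global_type_realization:
  assumes "p \<in> global_types M M'"
  obtains b where "b \<in> lists (univ M')"
    "\<And>A x. finite A \<Longrightarrow> A \<subseteq> univ M \<Longrightarrow> x \<in> p A \<longleftrightarrow> conj_over M' A b x"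
proof -
  have "\<exists>b \<in> lists (univ M'). \<forall>A \<subseteq> univ M. finite A \<longrightarrow> b \<in> p A"
    using assms by (simp add: global_types_def)
  then obtain b where b: "b \<in> lists (univ M')" "\<And>A. A \<subseteq> univ M \<Longrightarrow> finite A \<Longrightarrow> b \<in> p A"
    by blast
  show ?thesis
  proof (rule that[OF b(1)])
    fix A x
    assume A: "finite A" "A \<subseteq> univ M"
    then have "p A \<in> gtp M' A ` lists (univ M')"
      using assms by (simp add: global_types_def)
    then obtain e where e: "e \<in> lists (univ M')" "p A = gtp M' A e"
      by blast
    have AM': "A \<subseteq> univ M'"
      using A(2) M_sub by blast
    have "conj_over M' A e b"
      using b(2)[OF A(2,1)] by (simp add: e(2) in_gtp_iff)
    then have "gtp M' A e = gtp M' A b"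
      by (simp add: gtp_eq_iff[OF M'_struct AM' e(1)])
    then show "x \<in> p A \<longleftrightarrow> conj_over M' A b x"
      by (simp add: e(2) in_gtp_iff)
  qed
qed

context
  fixes g
  assumes g: "g \<in> Aut M'" and gM: "g ` univ M = univ M"
begin

text \<open>Fixing \<open>p\<close> is tested on realizations in \<open>M\<close>, whereas
  \<open>b\<close> may lie outside \<open>M\<close>. Each finite piece of the type is realized by
  some \<open>x\<close> in \<open>M\<close>, and the conjugacy between \<open>x\<close> and
  \<open>b\<close> carries the condition across.\<close>

lemma fixed_iff_same_type:
  assumes b: "b \<in> lists (univ M')"
    and p: "\<And>A x. finite A \<Longrightarrow> A \<subseteq> univ M \<Longrightarrow> x \<in> p A \<longleftrightarrow> conj_over M' A b x"
  shows "(\<forall>A B. finite A \<longrightarrow> finite B \<longrightarrow> A \<subseteq> univ M \<longrightarrow> B \<subseteq> univ M \<longrightarrow> g ` B = A \<longrightarrow>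
      (\<forall>x \<in> lists (univ M). x \<in> p B \<longrightarrow> map g x \<in> p A)) \<longleftrightarrow>
    (\<forall>A. finite A \<longrightarrow> A \<subseteq> univ M \<longrightarrow> conj_over M' A b (map g b))" (is "?L \<longleftrightarrow> ?R")
proof
  assume L: ?L
  show ?R
  proof (intro allI impI)
    fix A assume A: "finite A" "A \<subseteq> univ M"
    then obtain B where B: "B \<subseteq> univ M" "finite B" "A = g ` B"
      using gM by (metis finite_subset_image)
    have BM': "B \<subseteq> univ M'"
      using B(1) M_sub by blast
    obtain x where x: "x \<in> lists (univ M)" "conj_over M' B b x"
      using realized_in_M[OF B(1) countable_finite[OF B(2)] b] .
    have "x \<in> p B"
      using x(2) by (simp add: p[OF B(2,1)])
    then have "map g x \<in> p A"
      using L[rule_format, OF A(1) B(2) A(2) B(1) B(3)[symmetric] x(1)] by simp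
    then have 1: "conj_over M' A b (map g x)"
      by (simp add: p[OF A])
    have "conj_over M' B x b"
      by (rule conj_over_sym[OF M'_struct BM' b x(2)])
    then have "conj_over M' A (map g x) (map g b)"
      unfolding B(3) by (rule conj_over_image[OF M'_struct BM' M_lists[OF x(1)] g])
    with 1 show "conj_over M' A b (map g b)"
      by (rule conj_over_trans)
  qed
next
  assume R: ?R
  show ?L
  proof (intro allI impI ballI)
    fix A B x
    assume AB: "finite A" "finite B" "A \<subseteq> univ M" "B \<subseteq> univ M" "g ` B = A"
      and x: "x \<in> lists (univ M)" "x \<in> p B"
    have BM': "B \<subseteq> univ M'"
      using AB(4) M_sub by blast
    have "conj_over M' B b x"
      using x(2) by (simp add: p[OF AB(2,4)])
    from conj_over_image[OF M'_struct BM' b g this]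
    have "conj_over M' A (map g b) (map g x)"
      by (simp add: AB(5))
    with R[rule_format, OF AB(1,3)] have "conj_over M' A b (map g x)"
      by (rule conj_over_trans)
    then show "map g x \<in> p A"
      by (simp add: p[OF AB(1,3)])
  qed
qed

text \<open>As \<open>g\<close> preserves types over the empty set and permutes
  \<open>univ M\<close>, membership of \<open>map g a @ d\<close> in some \<open>q c i\<close>
  becomes conjugacy of \<open>b @ c\<close> with \<open>map g b @ d\<close>. The relation then
  compares \<open>b\<close> with \<open>map g b\<close> over tuples of \<open>M\<close>.\<close>

lemma defining_rel_iff_same_type:
  assumes b: "b \<in> lists (univ M')" and a: "a \<in> lists (univ M)" and q: "defining_types M M' b a q"
  shows "(a, map g a) \<in> defining_rel M (length a) q \<longleftrightarrow>
    (\<forall>A. finite A \<longrightarrow> A \<subseteq> univ M \<longrightarrow> conj_over M' A b (map g b))" (is "?L \<longleftrightarrow> ?R")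
proof -
  have gb: "map g b \<in> lists (univ M')"
    by (rule Aut_lists[OF g b])
  have ga: "map g a \<in> lists (univ M)"
    using a gM by (auto simp: in_lists_conv_set)
  have q_a: "(\<exists>i. a @ d \<in> q c i) \<longleftrightarrow> conj_over M' {} (b @ c) (b @ d)"
    if "c \<in> lists (univ M)" "d \<in> lists (univ M)" for c d
    using q that b M_lists[OF that(1)] in_wtp_iff[OF M'_struct, of "{}" "b @ c" "b @ d"]
    unfolding defining_types_def by simp
  have q_ga: "(\<exists>i. map g a @ d \<in> q c i) \<longleftrightarrow> conj_over M' {} (b @ c) (map g b @ d)"
    if c: "c \<in> lists (univ M)" and d: "d \<in> lists (univ M)" for c d
  proof -
    \<comment> \<open>The defining types are known only on tuples beginning with \<open>a\<close>,
      so \<open>d\<close> is pulled back along \<open>g\<close>.\<close>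
    have "d \<in> map g ` lists (univ M)"
      using d gM by (metis lists_image)
    then obtain d' where d': "d' \<in> lists (univ M)" "d = map g d'"
      by blast
    have "map g a @ d \<in> q c i \<longleftrightarrow> a @ d' \<in> q c i" for i
    proof -
      obtain e where e: "e \<in> lists (univ M')" "q c i = wtp M' {} e"
        using q c unfolding defining_types_def by blast
      have "a @ d' \<in> lists (univ M')"
        using a d'(1) M_lists by simp
      from conj_over_empty_Aut_iff[OF M'_struct this g, of e] show ?thesis
        using in_wtp_iff[OF M'_struct _ _ e(1), of "{}"] by (simp add: e(2) d'(2))
    qed
    moreover have "b @ d' \<in> lists (univ M')"
      using b d'(1) M_lists by simp
    from conj_over_empty_Aut_iff[OF M'_struct this g, of "b @ c"]
    have "conj_over M' {} (b @ c) (map g b @ d) \<longleftrightarrow> conj_over M' {} (b @ c) (b @ d')"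
      by (simp add: d'(2))
    ultimately show ?thesis
      using q_a[OF c d'(1)] by simp
  qed
  have "?L \<longleftrightarrow> (\<forall>c \<in> lists (univ M). \<forall>d \<in> lists (univ M).
      conj_over M' {} (b @ c) (b @ d) \<longleftrightarrow> conj_over M' {} (b @ c) (map g b @ d))"
    using a ga by (simp add: defining_rel_def tuples_def q_a q_ga)
  also have "\<dots> \<longleftrightarrow> ?R"
  proof
    assume L: "\<forall>c \<in> lists (univ M). \<forall>d \<in> lists (univ M).
      conj_over M' {} (b @ c) (b @ d) \<longleftrightarrow> conj_over M' {} (b @ c) (map g b @ d)"
    show ?R
    proof (intro allI impI)
      fix A assume A: "finite A" "A \<subseteq> univ M"
      then obtain d where d: "set d = A"
        using finite_list by blast
      then have "d \<in> lists (univ M)"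
        using A(2) by (simp add: in_lists_conv_set subset_iff)
      \<comment> \<open>For \<open>c = d\<close> the left side holds trivially; afterwards the
        entries of \<open>d\<close> move from the tuple into the base set.\<close>
      then have "conj_over M' {} (b @ d) (map g b @ d)"
        using L conj_over_refl by blast
      from conj_over_unappend[OF this] show "conj_over M' A b (map g b)"
        by (simp add: d)
    qed
  next
    assume R: ?R
    have "conj_over M' {} (b @ c) (b @ d) \<longleftrightarrow> conj_over M' {} (b @ c) (map g b @ d)"
      if d: "d \<in> lists (univ M)" for c d
    proof -
      have "conj_over M' (set d) b (map g b)"
        using R d by auto
      then have 1: "conj_over M' {} (b @ d) (map g b @ d)"
        using conj_over_append[of M' "set d"] conj_over_mono[of "{}" "set d"] by blast
      have "b @ d \<in> lists (univ M')"
        using b d M_lists by simp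
      from conj_over_sym[OF M'_struct _ this 1]
      have "conj_over M' {} (map g b @ d) (b @ d)"
        by simp
      with 1 show ?thesis
        using conj_over_trans by blast
    qed
    then show "\<forall>c \<in> lists (univ M). \<forall>d \<in> lists (univ M).
        conj_over M' {} (b @ c) (b @ d) \<longleftrightarrow> conj_over M' {} (b @ c) (map g b @ d)"
      by blast
  qed
  finally show ?thesis .
qed

end

end

theorem lemma2p77:
  fixes \<K> :: "('s, 'a) kclass" and \<delta> :: "'d rel"
    and M M' :: "('s, 'a) fostruct" and \<E> :: "'a list rel set"
    and p :: "'a set \<Rightarrow> 'a list set"
  assumes "monster \<K> \<delta> M"
    and "fur_class \<K> \<delta> M"
    and "supermonster \<K> M M'"
    and "imaginary_rels M \<E>"
    and "contains_defining_rels M M' \<E>"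
    and "p \<in> global_types M M'"
  shows "\<exists>\<alpha> \<in> univ (Meq M \<E>). canonical_base M \<E> \<alpha> p"
proof -
  have fur: "is_aec \<K>" "LS_omega \<K>" "\<forall>A \<in> members \<K>. infinite (univ A)" "axiom_AIV \<K> \<delta> M"
    using assms(2) unfolding fur_class_def by - (elim conjE, assumption)+
  interpret monster_pair \<K> \<delta> M M'
    by unfold_locales (use fur(1-3) assms(1,3) in blast)+
  interpret imaginary_sorts "voc \<K>" M \<E>
  proof
    fix E assume "E \<in> \<E>"
    moreover have "\<forall>E \<in> \<E>. \<exists>n. equiv (tuples M n) E"
      using assms(4) unfolding imaginary_rels_def by meson
    ultimately obtain n where "equiv (tuples M n) E"
      by blast
    then have "E \<subseteq> tuples M n \<times> tuples M n"
      by (simp add: equiv_def)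
    then show "Field E \<subseteq> lists (univ M)"
      by (auto simp: Field_def tuples_def)
  next
    show "is_struct (voc \<K>) M"
      by (rule M_struct)
    show "equality_rel M \<in> \<E>"
      using assms(4) by (simp add: imaginary_rels_def)
  qed
  obtain b where b: "b \<in> lists (univ M')"
    and p: "\<And>A x. finite A \<Longrightarrow> A \<subseteq> univ M \<Longrightarrow> x \<in> p A \<longleftrightarrow> conj_over M' A b x"
    using global_type_realization[OF assms(6)] by metis
  obtain a where a: "a \<in> lists (univ M)" "\<not> splits M' b (univ M) (set a)"
    using not_splits_finite[OF fur(4) b] .
  have "\<forall>A \<subseteq> univ M. finite A \<longrightarrow> b \<in> p A"
    by (simp add: p conj_over_refl)
  moreover have "(\<forall>A \<subseteq> univ M. finite A \<longrightarrow> b \<in> p A) \<longrightarrow> \<not> splits M' b (univ M) (set a) \<longrightarrow>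
      (\<exists>q. defining_types M M' b a q \<and> defining_rel M (length a) q \<in> \<E>)"
    by (rule bspec[OF bspec[OF bspec[OF assms(5)[unfolded contains_defining_rels_def] assms(6)] b] a(1)])
  ultimately obtain q where q: "defining_types M M' b a q" "defining_rel M (length a) q \<in> \<E>"
    using a(2) by metis
  \<comment> \<open>The canonical base will be the class of \<open>a\<close> under this relation,
    which the standing choice puts into \<open>\<E>\<close>.\<close>
  define E where "E = defining_rel M (length a) q"
  have equiv: "equiv (tuples M (length a)) E"
    unfolding E_def by (rule equiv_defining_rel)
  have aE: "a \<in> tuples M (length a)"
    using a(1) by (simp add: tuples_def)
  then have "(a, a) \<in> E"
    using equiv by (simp add: equiv_def refl_on_def)
  then have aF: "a \<in> Field E"
    by (rule FieldI1)
  have \<alpha>: "imag E a \<in> univ (Meq M \<E>)"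
    using q(2) aF by (auto simp: Meq_def E_def)
  have "fixes_global_type M f p \<longleftrightarrow> f (imag E a) = imag E a" if f: "f \<in> Aut (Meq M \<E>)" for f
  proof -
    let ?f = "base_map f"
    have f_Aut: "?f \<in> Aut M"
      by (rule base_map_Aut[OF f])
    \<comment> \<open>The restriction of \<open>f\<close> to the home sort is extended to
      \<open>M'\<close>, so that it can be applied to \<open>b\<close>.\<close>
    obtain g where g: "g \<in> Aut M'" "\<And>x. x \<in> univ M \<Longrightarrow> g x = ?f x"
      using Aut_extend[OF f_Aut] by blast
    have gM: "g ` univ M = univ M"
      using Aut_bij[OF f_Aut] g(2) by (simp add: bij_betw_def)
    have map_eq: "map ?f x = map g x" if "x \<in> lists (univ M)" for x
      using that g(2) by (auto simp: in_lists_conv_set)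
    have image_eq: "?f ` B = g ` B" if "B \<subseteq> univ M" for B
      using that g(2) by (intro image_cong) auto
    have "fixes_global_type M f p \<longleftrightarrow> (\<forall>A B. finite A \<longrightarrow> finite B \<longrightarrow> A \<subseteq> univ M \<longrightarrow> B \<subseteq> univ M \<longrightarrow>
        g ` B = A \<longrightarrow> (\<forall>x \<in> lists (univ M). x \<in> p B \<longrightarrow> map g x \<in> p A))"
      unfolding fixes_global_type_def Let_def
      by (simp add: map_eq image_eq cong: imp_cong)
    also have "\<dots> \<longleftrightarrow> (\<forall>A. finite A \<longrightarrow> A \<subseteq> univ M \<longrightarrow> conj_over M' A b (map g b))"
      by (rule fixed_iff_same_type[OF g(1) gM b p])
    also have "\<dots> \<longleftrightarrow> (a, map g a) \<in> E"
      unfolding E_def by (rule defining_rel_iff_same_type[OF g(1) gM b a(1) q(1), symmetric])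
    \<comment> \<open>Both imaginaries carry the same \<open>E\<close>, so they are equal exactly
      when the equivalence classes are.\<close>
    also have "\<dots> \<longleftrightarrow> imag E (map g a) = imag E a"
    proof -
      have "map g a \<in> tuples M (length a)"
        using a(1) gM by (auto simp: tuples_def in_lists_conv_set)
      then show ?thesis
        using eq_equiv_class_iff[OF equiv aE] by (auto simp: imag_def)
    qed
    also have "imag E (map g a) = f (imag E a)"
      using f_imag[OF f, of E a] q(2) aF map_eq[OF a(1)] by (simp add: E_def)
    finally show ?thesis .
  qed
  with \<alpha> show ?thesis
    unfolding canonical_base_def by blast
qed

end
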